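(* Let $M(t)$ be the $N\times N$ non-Hermitian matrix-valued Brownian motion started from a deterministic matrix with simple spectrum, with eigenvalue process $(\Lambda_j(t))_{j=1}^N$, and let $S(t)$, $A(t)=S^\dagger(t)S(t)$, $\mathcal{O}_{jk}(t)=A^{-1}_{jk}(t)A_{kj}(t)$ be as in the context. Consider the system of SDEs for the eigenvector-overlap process: for $1\le j,k\le N$, $t\ge0$, $$d\mathcal{O}_{jk}(t)=d\mathcal{M}^{\mathcal{O}}_{jk}(t)+\frac{2}{N}\sum_{\substack{1\le \ell,m\le N:\\ \ell\ne j,\ m\ne k}}\frac{\mathcal{O}_{jk}(t)\mathcal{O}_{\ell m}(t)+\mathcal{O}_{\ell k}(t)\mathcal{O}_{jm}(t)}{(\Lambda_j(t)-\Lambda_\ell(t))(\overline{\Lambda_k(t)}-\overline{\Lambda_m(t)})}\,dt,$$ $$d\mathcal{M}^{\mathcal{O}}_{jk}(t)=\sum_{\ell\ne j}\frac{A^{-1}_{jk}(t)A_{k\ell}(t)(S^{-1}(t)dM(t)S(t))_{\ell j}+A_{kj}(t)A^{-1}_{\ell k}(t)(S^{-1}(t)dM(t)S(t))_{j\ell}}{\Lambda_j(t)-\Lambda_\ell(t)}$$ $$\qquad+\sum_{\ell\ne k}\frac{A^{-1}_{jk}(t)A_{\ell j}(t)\overline{(S^{-1}(t)dM(t)S(t))_{\ell k}}+A_{kj}(t)A^{-1}_{j\ell}(t)\overline{(S^{-1}(t)dM(t)S(t))_{k\ell}}}{\overline{\Lambda_k(t)}-\overline{\Lambda_\ell(t)}}.$$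 This system is invariant under the scale transformation $$\boldsymbol R_j(t)\to c_j(t)\boldsymbol R_j(t),\qquad \boldsymbol L_j(t)\to\frac{1}{c_j(t)}\boldsymbol L_j(t),\qquad 1\le j\le N,$$ for any non-vanishing (complex) time-dependent factors $c_j(t)$, $1\le j\le N$, $t\ge0$; that is, $\mathcal{O}_{jk}(t)$, the coefficient of $dt$, and the coefficients of the increments $dM_{pq}(t)$ and $d\overline{M_{pq}(t)}$ on the right-hand side, for all $j,k,p,q$, do not change when $S(t)$ is replaced by $S(t)\,\mathrm{diag}(c_1(t),\dots,c_N(t))$ (and $S^{-1}(t)$, $A(t)$, $A^{-1}(t)$ accordingly). In other words, although the right and left eigenvector processes cannot be determined uniquely for the given eigenvalue process, the system of SDEs for the eigenvector-overlap process $(\mathcal{O}(t))_{t\ge0}$ is uniquely determined.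
   Context: Let $(B^{\rm R}_{jk}(t))_{t\ge0},(B^{\rm I}_{jk}(t))_{t\ge0}$, $1\le j,k\le N$, be $2N^2$ independent one-dimensional standard Brownian motions on a filtered probability space. The non-Hermitian matrix-valued Brownian motion $M(t)=(M_{jk}(t))_{1\le j,k\le N}$ starts from a deterministic matrix $M(0)$ and has increments $dM_{jk}(t)=(dB^{\rm R}_{jk}(t)+i\,dB^{\rm I}_{jk}(t))/\sqrt{2N}$. Standing assumption: the spectrum of $M(0)$ is simple. Then, almost surely, the eigenvalues of $M(t)$ are distinct for all $t\ge0$; they are labeled as continuous processes $\Lambda_1(t),\dots,\Lambda_N(t)$, with the labels at $t=0$ fixed by the lexicographic order on $\mathbb{C}\simeq\mathbb{R}^2$. The right and left eigenvectors $\boldsymbol R_j(t)=(R_{jk}(t))_{k=1}^N$, $\boldsymbol L_j(t)=(L_{jk}(t))_{k=1}^N$ satisfy $M(t)\boldsymbol R_j(t)=\Lambda_j(t)\boldsymbol R_j(t)$, $\boldsymbol L_j^{\rm t}(t)M(t)=\Lambda_j(t)\boldsymbol L_j^{\rm t}(t)$ and the bi-orthogonality relation $\sum_{\ell=1}^N L_{j\ell}(t)R_{k\ell}(t)=\delta_{jk}$. $S(t)$ is the matrix whose $j$-th column is $\boldsymbol R_j(t)$; then $S^{-1}(t)$ has $j$-th row $\boldsymbol L_j^{\rm t}(t)$. $S^\dagger$ denotes the Hermitian conjugate. $A(t):=S^\dagger(t)S(t)$, $A^{-1}(t)=S^{-1}(t)(S^{-1})^\dagger(t)$, with entries $A_{jk}(t)$,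 $A^{-1}_{jk}(t)$. The eigenvector-overlap process is $\mathcal{O}(t)=(\mathcal{O}_{jk}(t))$ with $\mathcal{O}_{jk}(t)=A^{-1}_{jk}(t)A_{kj}(t)$. Sums without explicit range run over $1\le\ell\le N$ with the indicated restriction. *)

theory Defs
  imports
    "HOL-Probability.Probability"
    "Jordan_Normal_Form.Schur_Decomposition"
begin

unbundle no vec_syntax

hide_const (open) Finite_Cartesian_Product.mat Finite_Cartesian_Product.vec
  Finite_Cartesian_Product.row Determinants.det

section \<open>The non-Hermitian matrix-valued Brownian motion\<close>

definition filtered_prob_space :: "'w measure \<Rightarrow> (real \<Rightarrow> 'w measure) \<Rightarrow> bool" where
  "filtered_prob_space P F \<longleftrightarrow>
     prob_space P \<and> (\<forall>t\<ge>0. subalgebra P (F t)) \<and>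
     (\<forall>s t. 0 \<le> s \<and> s \<le> t \<longrightarrow> sets (F s) \<subseteq> sets (F t))"

definition increment_events ::
    "'w measure \<Rightarrow> (real \<Rightarrow> 'w \<Rightarrow> real) \<Rightarrow> real \<Rightarrow> real \<Rightarrow> 'w set set" where
  "increment_events P W s t = {(\<lambda>\<omega>. W t \<omega> - W s \<omega>) -` X \<inter> space P | X. X \<in> sets borel}"

definition standard_brownian_motion ::
    "'w measure \<Rightarrow> (real \<Rightarrow> 'w measure) \<Rightarrow> (real \<Rightarrow> 'w \<Rightarrow> real) \<Rightarrow> bool" where
  "standard_brownian_motion P F W \<longleftrightarrow>
     (\<forall>t\<ge>0. W t \<in> borel_measurable (F t)) \<and>
     (AE \<omega> in P. W 0 \<omega> = 0) \<and>
     (AE \<omega> in P. continuous_on {0..} (\<lambda>t. W t \<omega>)) \<and>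
     (\<forall>s t. 0 \<le> s \<and> s < t \<longrightarrow>
        distributed P lborel (\<lambda>\<omega>. W t \<omega> - W s \<omega>) (normal_density 0 (sqrt (t - s))) \<and>
        prob_space.indep_set P (sets (F s)) (increment_events P W s t))"

text \<open>Independence of Brownian motions on a common filtered space is understood relative to the
  filtration: the increments of all components over \<open>[s, t]\<close> and the \<open>\<sigma>\<close>-algebra at time \<open>s\<close>
  (index \<open>None\<close>) are mutually independent. For the filtration generated by the processes this
  is the same as the mutual independence of the processes.\<close>

definition independent_brownian_motions ::
    "'w measure \<Rightarrow> (real \<Rightarrow> 'w measure) \<Rightarrow> 'i set \<Rightarrow> ('i \<Rightarrow> real \<Rightarrow> 'w \<Rightarrow> real) \<Rightarrow> bool" where
  "independent_brownian_motions P F I W \<longleftrightarrow>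
     (\<forall>i\<in>I. standard_brownian_motion P F (W i)) \<and>
     (\<forall>s t. 0 \<le> s \<and> s < t \<longrightarrow>
        prob_space.indep_sets P
          (\<lambda>x. case x of None \<Rightarrow> sets (F s) | Some i \<Rightarrow> increment_events P (W i) s t)
          (insert None (Some ` I)))"

text \<open>All matrix indices run over \<open>{..<N}\<close> instead of \<open>{1..N}\<close>.\<close>

definition matrix_brownian_motion ::
    "nat \<Rightarrow> complex mat \<Rightarrow> (nat \<times> nat \<Rightarrow> real \<Rightarrow> 'w \<Rightarrow> real) \<Rightarrow> (nat \<times> nat \<Rightarrow> real \<Rightarrow> 'w \<Rightarrow> real)
     \<Rightarrow> real \<Rightarrow> 'w \<Rightarrow> complex mat" where
  "matrix_brownian_motion N M0 BR BI t \<omega> =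
     Matrix.mat N N (\<lambda>(j, k). M0 $$ (j, k) +
       (complex_of_real (BR (j, k) t \<omega>) + \<i> * complex_of_real (BI (j, k) t \<omega>))
         / complex_of_real (sqrt (2 * real N)))"

definition simple_spectrum :: "complex mat \<Rightarrow> bool" where
  "simple_spectrum A \<longleftrightarrow> (\<forall>z. eigenvalue A z \<longrightarrow> Polynomial.order z (char_poly A) = 1)"

section \<open>Eigenvalues and eigenvectors\<close>

definition complex_lex_less :: "complex \<Rightarrow> complex \<Rightarrow> bool" where
  "complex_lex_less z w \<longleftrightarrow> Re z < Re w \<or> Re z = Re w \<and> Im z < Im w"

text \<open>The eigenvalues are listed with their algebraic multiplicities, so that their distinctness
  at positive times is not part of the definition.\<close>

definition eigenvalue_process ::
    "'w measure \<Rightarrow> nat \<Rightarrow> (real \<Rightarrow> 'w \<Rightarrow> complex mat) \<Rightarrow> (nat \<Rightarrow> real \<Rightarrow> 'w \<Rightarrow> complex) \<Rightarrow> bool" where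
  "eigenvalue_process P N M \<Lambda> \<longleftrightarrow> (AE \<omega> in P.
     (\<forall>j<N. continuous_on {0..} (\<lambda>t. \<Lambda> j t \<omega>)) \<and>
     (\<forall>t\<ge>0. char_poly (M t \<omega>) = (\<Prod>j<N. [:- \<Lambda> j t \<omega>, 1:])) \<and>
     (\<forall>j k. j < k \<and> k < N \<longrightarrow> complex_lex_less (\<Lambda> j 0 \<omega>) (\<Lambda> k 0 \<omega>)))"

text \<open>The relation \<open>L\<^sub>j\<^sup>t M = \<Lambda>\<^sub>j L\<^sub>j\<^sup>t\<close> is written in transposed form, and \<open>scalar_prod\<close> is bilinear
  (unconjugated).\<close>

definition biorthogonal_eigenvectors ::
    "nat \<Rightarrow> complex mat \<Rightarrow> (nat \<Rightarrow> complex) \<Rightarrow> (nat \<Rightarrow> complex Matrix.vec) \<Rightarrow>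
     (nat \<Rightarrow> complex Matrix.vec) \<Rightarrow> bool" where
  "biorthogonal_eigenvectors N A lam r l \<longleftrightarrow>
     (\<forall>j<N. eigenvector A (r j) (lam j)) \<and>
     (\<forall>j<N. eigenvector (transpose_mat A) (l j) (lam j)) \<and>
     (\<forall>j<N. \<forall>k<N. scalar_prod (l j) (r k) = (if j = k then 1 else 0))"

definition eigenvector_process ::
    "'w measure \<Rightarrow> nat \<Rightarrow> (real \<Rightarrow> 'w \<Rightarrow> complex mat) \<Rightarrow> (nat \<Rightarrow> real \<Rightarrow> 'w \<Rightarrow> complex) \<Rightarrow>
     (nat \<Rightarrow> real \<Rightarrow> 'w \<Rightarrow> complex Matrix.vec) \<Rightarrow>
     (nat \<Rightarrow> real \<Rightarrow> 'w \<Rightarrow> complex Matrix.vec) \<Rightarrow> bool" where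
  "eigenvector_process P N M \<Lambda> R L \<longleftrightarrow>
     (AE \<omega> in P. \<forall>t\<ge>0. biorthogonal_eigenvectors N (M t \<omega>)
        (\<lambda>j. \<Lambda> j t \<omega>) (\<lambda>j. R j t \<omega>) (\<lambda>j. L j t \<omega>))"

definition eigenvector_matrix :: "nat \<Rightarrow> (nat \<Rightarrow> complex Matrix.vec) \<Rightarrow> complex mat" where
  "eigenvector_matrix N r = mat_of_cols N (map r [0..<N])"

section \<open>The system of SDEs for the eigenvector-overlap process\<close>

text \<open>The matrix inverse; its value on singular matrices is irrelevant.\<close>

definition minv :: "complex mat \<Rightarrow> complex mat" where
  "minv S = the (mat_inverse S)"

definition gram :: "complex mat \<Rightarrow> complex mat" where
  "gram S = mat_adjoint S * S"

definition overlap :: "complex mat \<Rightarrow> nat \<Rightarrow> nat \<Rightarrow> complex" where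
  "overlap S j k = minv (gram S) $$ (j, k) * gram S $$ (k, j)"

definition overlap_drift ::
    "nat \<Rightarrow> (nat \<Rightarrow> complex) \<Rightarrow> complex mat \<Rightarrow> nat \<Rightarrow> nat \<Rightarrow> complex" where
  "overlap_drift N lam S j k =
     2 / of_nat N * (\<Sum>l\<in>{..<N} - {j}. \<Sum>m\<in>{..<N} - {k}.
       (overlap S j k * overlap S l m + overlap S l k * overlap S j m) /
       ((lam j - lam l) * (cnj (lam k) - cnj (lam m))))"

text \<open>The martingale part as a function of a matrix increment \<open>X\<close> in place of \<open>dM(t)\<close>.\<close>

definition overlap_martingale ::
    "nat \<Rightarrow> (nat \<Rightarrow> complex) \<Rightarrow> complex mat \<Rightarrow> nat \<Rightarrow> nat \<Rightarrow> complex mat \<Rightarrow> complex" where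
  "overlap_martingale N lam S j k X =
     (let A = gram S; B = minv (gram S); Y = minv S * X * S in
      (\<Sum>l\<in>{..<N} - {j}.
         (B $$ (j, k) * A $$ (k, l) * Y $$ (l, j) + A $$ (k, j) * B $$ (l, k) * Y $$ (j, l)) /
         (lam j - lam l)) +
      (\<Sum>l\<in>{..<N} - {k}.
         (B $$ (j, k) * A $$ (l, j) * cnj (Y $$ (l, k)) +
          A $$ (k, j) * B $$ (j, l) * cnj (Y $$ (k, l))) /
         (cnj (lam k) - cnj (lam l))))"

text \<open>The coefficients of the increments of \<open>M\<^sub>p\<^sub>q\<close> and of its complex conjugate, obtained from
  \<open>(S\<^sup>-\<^sup>1 X S)\<^sub>a\<^sub>b = (\<Sum>p q. S\<^sup>-\<^sup>1\<^sub>a\<^sub>p S\<^sub>q\<^sub>b X\<^sub>p\<^sub>q)\<close>; see \<open>overlap_martingale_expansion\<close> below.\<close>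

definition overlap_coeff_dM ::
    "nat \<Rightarrow> (nat \<Rightarrow> complex) \<Rightarrow> complex mat \<Rightarrow> nat \<Rightarrow> nat \<Rightarrow> nat \<Rightarrow> nat \<Rightarrow> complex" where
  "overlap_coeff_dM N lam S j k p q =
     (let A = gram S; B = minv (gram S); T = minv S in
      \<Sum>l\<in>{..<N} - {j}.
        (B $$ (j, k) * A $$ (k, l) * (T $$ (l, p) * S $$ (q, j)) +
         A $$ (k, j) * B $$ (l, k) * (T $$ (j, p) * S $$ (q, l))) /
        (lam j - lam l))"

definition overlap_coeff_dMbar ::
    "nat \<Rightarrow> (nat \<Rightarrow> complex) \<Rightarrow> complex mat \<Rightarrow> nat \<Rightarrow> nat \<Rightarrow> nat \<Rightarrow> nat \<Rightarrow> complex" where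
  "overlap_coeff_dMbar N lam S j k p q =
     (let A = gram S; B = minv (gram S); T = minv S in
      \<Sum>l\<in>{..<N} - {k}.
        (B $$ (j, k) * A $$ (l, j) * cnj (T $$ (l, p) * S $$ (q, k)) +
         A $$ (k, j) * B $$ (j, l) * cnj (T $$ (k, p) * S $$ (q, l))) /
        (cnj (lam k) - cnj (lam l)))"

definition same_overlap_system ::
    "nat \<Rightarrow> (nat \<Rightarrow> complex) \<Rightarrow> complex mat \<Rightarrow> complex mat \<Rightarrow> bool" where
  "same_overlap_system N lam S S' \<longleftrightarrow>
     (\<forall>j<N. \<forall>k<N.
        overlap S j k = overlap S' j k \<and>
        overlap_drift N lam S j k = overlap_drift N lam S' j k \<and>
        (\<forall>p<N. \<forall>q<N.
           overlap_coeff_dM N lam S j k p q = overlap_coeff_dM N lam S' j k p q \<and>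
           overlap_coeff_dMbar N lam S j k p q = overlap_coeff_dMbar N lam S' j k p q))"

lemma conj_entry_expansion:
  fixes S T X :: "complex mat"
  assumes "S \<in> carrier_mat N N" "T \<in> carrier_mat N N" "X \<in> carrier_mat N N" "a < N" "b < N"
  shows "(T * X * S) $$ (a, b) = (\<Sum>p<N. \<Sum>q<N. T $$ (a, p) * S $$ (q, b) * X $$ (p, q))"
  using assms
  by (simp add: scalar_prod_def atLeast0LessThan sum_distrib_left mult_ac)

lemma double_sum_linear:
  fixes u v :: "nat \<Rightarrow> nat \<Rightarrow> nat \<Rightarrow> complex" and x :: "nat \<Rightarrow> nat \<Rightarrow> complex"
  shows "(\<Sum>l\<in>I. (a l * (\<Sum>p<N. \<Sum>q<N. u l p q * x p q) + b l * (\<Sum>p<N. \<Sum>q<N. v l p q * x p q)) / d l)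
    = (\<Sum>p<N. \<Sum>q<N. (\<Sum>l\<in>I. (a l * u l p q + b l * v l p q) / d l) * x p q)"
proof -
  have "(\<Sum>l\<in>I. (a l * (\<Sum>p<N. \<Sum>q<N. u l p q * x p q) + b l * (\<Sum>p<N. \<Sum>q<N. v l p q * x p q)) / d l)
    = (\<Sum>l\<in>I. \<Sum>p<N. \<Sum>q<N. (a l * u l p q + b l * v l p q) / d l * x p q)"
    by (simp add: sum_distrib_left sum_divide_distrib sum.distrib add_divide_distrib
        distrib_right mult.assoc)
  also have "\<dots> = (\<Sum>p<N. \<Sum>l\<in>I. \<Sum>q<N. (a l * u l p q + b l * v l p q) / d l * x p q)"
    by (rule sum.swap)
  also have "\<dots> = (\<Sum>p<N. \<Sum>q<N. \<Sum>l\<in>I. (a l * u l p q + b l * v l p q) / d l * x p q)"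
    by (rule sum.cong[OF refl], rule sum.swap)
  finally show ?thesis
    by (simp only: sum_distrib_right)
qed

lemma overlap_martingale_expansion:
  assumes S: "S \<in> carrier_mat N N" and T: "minv S \<in> carrier_mat N N"
    and X: "X \<in> carrier_mat N N" and jk: "j < N" "k < N"
  shows "overlap_martingale N lam S j k X =
    (\<Sum>p<N. \<Sum>q<N. overlap_coeff_dM N lam S j k p q * X $$ (p, q) +
                    overlap_coeff_dMbar N lam S j k p q * cnj (X $$ (p, q)))"
proof -
  let ?A = "gram S" and ?B = "minv (gram S)" and ?T = "minv S" and ?Y = "minv S * X * S"
  have E: "?Y $$ (a, b) = (\<Sum>p<N. \<Sum>q<N. (?T $$ (a, p) * S $$ (q, b)) * X $$ (p, q))"
    if "a < N" "b < N" for a b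
    using conj_entry_expansion[OF S T X that] .
  have E': "cnj (?Y $$ (a, b)) =
      (\<Sum>p<N. \<Sum>q<N. cnj (?T $$ (a, p) * S $$ (q, b)) * cnj (X $$ (p, q)))"
    if "a < N" "b < N" for a b
    unfolding E[OF that] by (simp only: cnj_sum complex_cnj_mult)
  have 1: "(\<Sum>l\<in>{..<N} - {j}.
        (?B $$ (j, k) * ?A $$ (k, l) * ?Y $$ (l, j) + ?A $$ (k, j) * ?B $$ (l, k) * ?Y $$ (j, l)) /
        (lam j - lam l)) = (\<Sum>p<N. \<Sum>q<N. overlap_coeff_dM N lam S j k p q * X $$ (p, q))"
    unfolding overlap_coeff_dM_def Let_def double_sum_linear[symmetric]
    by (intro sum.cong refl) (use jk in \<open>simp only: E Diff_iff lessThan_iff\<close>)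
  have 2: "(\<Sum>l\<in>{..<N} - {k}.
        (?B $$ (j, k) * ?A $$ (l, j) * cnj (?Y $$ (l, k)) +
         ?A $$ (k, j) * ?B $$ (j, l) * cnj (?Y $$ (k, l))) /
        (cnj (lam k) - cnj (lam l))) =
      (\<Sum>p<N. \<Sum>q<N. overlap_coeff_dMbar N lam S j k p q * cnj (X $$ (p, q)))"
    unfolding overlap_coeff_dMbar_def Let_def double_sum_linear[symmetric]
    by (intro sum.cong refl) (use jk in \<open>simp only: E' Diff_iff lessThan_iff\<close>)
  show ?thesis
    unfolding overlap_martingale_def Let_def 1 2 by (simp only: sum.distrib)
qed

text \<open>The inverse matrices appearing above are the ones built from the left eigenvectors.\<close>

lemma minv_eqI:
  assumes "S \<in> carrier_mat N N" "T \<in> carrier_mat N N" "T * S = 1\<^sub>m N"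
  shows "minv S = T"
proof -
  have ST: "S * T = 1\<^sub>m N"
    using mat_mult_left_right_inverse[OF assms(2,1,3)] .
  then have "S \<in> Units (ring_mat TYPE(complex) N ())"
    using assms by (auto simp: Units_def ring_mat_def)
  then obtain U where U: "mat_inverse S = Some U"
    using mat_inverse(1)[OF assms(1), of "()"] by (cases "mat_inverse S") auto
  then have SU: "S * U = 1\<^sub>m N" and Uc: "U \<in> carrier_mat N N"
    using mat_inverse(2)[OF assms(1)] by auto
  have "U = (T * S) * U"
    using assms(3) Uc by simp
  also have "\<dots> = T"
    using assoc_mult_mat[OF assms(2,1) Uc] SU assms(2) by simp
  finally have "U = T" .
  with U show ?thesis
    by (simp add: minv_def)
qed

lemma minv_eigenvector_matrix:
  assumes "A \<in> carrier_mat N N" "biorthogonal_eigenvectors N A lam r l"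
  shows "minv (eigenvector_matrix N r) = mat_of_rows N (map l [0..<N])"
proof (rule minv_eqI)
  have c: "r j \<in> carrier_vec N" "l j \<in> carrier_vec N" if "j < N" for j
    using assms that by (auto simp: biorthogonal_eigenvectors_def eigenvector_def)
  show "mat_of_rows N (map l [0..<N]) * eigenvector_matrix N r = 1\<^sub>m N"
    using assms c
    by (intro eq_matI) (auto simp: eigenvector_matrix_def biorthogonal_eigenvectors_def)
qed (auto simp: eigenvector_matrix_def mat_of_cols_def mat_of_rows_def)

end

theory Submission
  imports Defs
begin

text \<open>
  Replacing \<open>S\<close> by \<open>S D\<close> with \<open>D = diag(c\<^sub>1, \<dots>, c\<^sub>N)\<close> multiplies \<open>A\<^sub>j\<^sub>k\<close> by \<open>cnj c\<^sub>j c\<^sub>k\<close>, divides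
  \<open>(A\<^sup>-\<^sup>1)\<^sub>j\<^sub>k\<close> by \<open>c\<^sub>j cnj c\<^sub>k\<close>, multiplies the \<open>j\<close>-th column of \<open>S\<close> by \<open>c\<^sub>j\<close> and divides the \<open>j\<close>-th row
  of \<open>S\<^sup>-\<^sup>1\<close> by \<open>c\<^sub>j\<close>. In each term of the system these factors cancel, which is the invariance
  (\<open>same_overlap_system_scale\<close>). Scaling by \<open>2\<close> shows that the eigenvectors are not unique.

  That the system is nevertheless determined by the eigenvalues amounts to the statement that
  the scalings are the only freedom in the choice of the eigenvectors. This holds as
  soon as the eigenvalues are distinct (\<open>biorthogonal_eigenvectors_unique\<close>), so it has to be shown
  that almost surely they are distinct at all times. At time \<open>0\<close> this is the strict lexicographic
  order of the labels. At positive times the existence of biorthogonal eigenvectors helps: it makes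
  \<open>M(t)\<close> diagonalizable, so that a collision \<open>z = \<Lambda>\<^sub>j = \<Lambda>\<^sub>k\<close> would make the kernel of \<open>M(t) - z\<close>
  at least two-dimensional, which is much rarer than a zero of the discriminant.
  Two columns of \<open>M(t) - z\<close> are then linear combinations of the other \<open>N - 2\<close>, and counting the free parameters
  (\<open>N (N - 2)\<close> entries, \<open>2 (N - 2)\<close> coefficients and \<open>z\<close>) shows that such matrices form
  polynomial images of a space of complex dimension \<open>N\<^sup>2 - 3\<close>
  (\<open>degenerate_parametrisation\<close>), that is, of real codimension \<open>6\<close>.

  A Brownian motion does not hit such a set at positive times
  (\<open>brownian_avoids_lipschitz_image\<close>). Cover it, in a bounded region, by
  \<open>O(\<eta> powr (6 - d))\<close> boxes of side \<open>\<eta>\<close>, where \<open>d\<close> is the dimension of the ambient space. At a fixed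
  time the path is in a given box with probability \<open>O(\<eta> ^ d)\<close>, so it is within distance \<open>\<eta>\<close> of the set
  with probability \<open>O(\<eta> ^ 6)\<close>. If the path is Hoelder continuous with an exponent above \<open>1/6\<close>, then
  testing at \<open>2 ^ n\<close> times with \<open>\<eta> = \<theta> ^ n\<close>, \<open>2 \<theta> ^ 6 < 1\<close>, suffices, and
  the probabilities are summable over \<open>n\<close>. The Hoelder continuity is
  the dyadic chaining argument of Kolmogorov (\<open>brownian_dyadic_modulus\<close>); with fourth moments of the
  increments it gives exponents below \<open>1/4\<close>, that is, \<open>2 \<theta> ^ 4 > 1\<close>. The value \<open>\<theta> = 7/8\<close>
  satisfies both conditions.
\<close>

section \<open>Scaling the eigenvectors\<close>

lemma mat_adjoint_carrier: "A \<in> carrier_mat m n \<Longrightarrow> mat_adjoint A \<in> carrier_mat n m"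
  by (auto simp: mat_adjoint_def)

lemma mat_adjoint_index:
  fixes A :: "complex mat"
  assumes "i < dim_col A" "j < dim_row A"
  shows "mat_adjoint A $$ (i, j) = cnj (A $$ (j, i))"
  using assms by (simp add: mat_adjoint_def mat_of_rows_def)

lemma mat_adjoint_times:
  fixes A B :: "complex mat"
  assumes "A \<in> carrier_mat m n" "B \<in> carrier_mat n k"
  shows "mat_adjoint (A * B) = mat_adjoint B * mat_adjoint A"
proof (rule eq_matI)
  have d: "mat_adjoint A \<in> carrier_mat n m" "mat_adjoint B \<in> carrier_mat k n"
    using assms by (auto intro: mat_adjoint_carrier)
  fix i j assume "i < dim_row (mat_adjoint B * mat_adjoint A)" "j < dim_col (mat_adjoint B * mat_adjoint A)"
  then have ij: "i < k" "j < m" using d by auto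
  show "mat_adjoint (A * B) $$ (i, j) = (mat_adjoint B * mat_adjoint A) $$ (i, j)"
    using assms d ij by (simp add: mat_adjoint_index scalar_prod_def mult.commute)
qed (use assms mat_adjoint_carrier[of "A * B" m k] mat_adjoint_carrier[of A m n] mat_adjoint_carrier[of B n k] in auto)

text \<open>The identity \<open>(S\<^sup>\<dagger> S)\<^sup>-\<^sup>1 = S\<^sup>-\<^sup>1 (S\<^sup>-\<^sup>1)\<^sup>\<dagger>\<close>, which reduces the scaling behaviour of \<open>A\<^sup>-\<^sup>1\<close> to that of
  the rows of \<open>S\<^sup>-\<^sup>1\<close>.\<close>
lemma minv_gram:
  assumes S: "S \<in> carrier_mat N N" and T: "T \<in> carrier_mat N N" and TS: "T * S = 1\<^sub>m N"
  shows "minv (gram S) = T * mat_adjoint T"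
proof (rule minv_eqI)
  have Sa: "mat_adjoint S \<in> carrier_mat N N" and Ta: "mat_adjoint T \<in> carrier_mat N N"
    using S T by (auto intro: mat_adjoint_carrier)
  have one: "mat_adjoint (1\<^sub>m N) = (1\<^sub>m N :: complex mat)"
    by (rule eq_matI)
      (use mat_adjoint_carrier[of "1\<^sub>m N :: complex mat" N N] in \<open>auto simp: mat_adjoint_index\<close>)
  have "S * T = 1\<^sub>m N" using mat_mult_left_right_inverse[OF T S TS] .
  then have TaSa: "mat_adjoint T * mat_adjoint S = 1\<^sub>m N"
    using mat_adjoint_times[OF S T] one by simp
  have "T * mat_adjoint T * gram S = T * (mat_adjoint T * (mat_adjoint S * S))"
    unfolding gram_def using S T Sa Ta by (intro assoc_mult_mat) auto
  also have "mat_adjoint T * (mat_adjoint S * S) = (mat_adjoint T * mat_adjoint S) * S"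
    using S T Sa Ta by (intro assoc_mult_mat[symmetric]) auto
  finally show "T * mat_adjoint T * gram S = 1\<^sub>m N"
    using TaSa TS S by simp
qed (use S T in \<open>auto simp: gram_def intro!: mult_carrier_mat mat_adjoint_carrier\<close>)

lemma inverse_times_diag:
  fixes S T :: "complex mat"
  assumes S: "S \<in> carrier_mat N N" and T: "T \<in> carrier_mat N N" and TS: "T * S = 1\<^sub>m N"
    and c: "\<forall>j<N. c j \<noteq> 0"
  shows "mat_diag N (\<lambda>j. 1 / c j) * T * (S * mat_diag N c) = 1\<^sub>m N"
proof -
  have D: "mat_diag N (\<lambda>j. 1 / c j) * mat_diag N c = 1\<^sub>m N"
    unfolding mat_diag_diag using c by (intro eq_matI) (auto simp: mat_diag_def)
  have "mat_diag N (\<lambda>j. 1 / c j) * T * (S * mat_diag N c)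
      = mat_diag N (\<lambda>j. 1 / c j) * (T * (S * mat_diag N c))"
    using S T by (intro assoc_mult_mat[of _ N N _ N _ N]) auto
  also have "T * (S * mat_diag N c) = T * S * mat_diag N c"
    using S T by (intro assoc_mult_mat[of _ N N _ N _ N, symmetric]) auto
  finally show ?thesis using TS D by (simp add: left_mult_one_mat[OF mat_diag_dim])
qed

text \<open>With the four scaling rules \<open>Ss\<close>, \<open>Ts\<close>, \<open>A\<close>, \<open>B\<close> below, the overlaps are invariant, hence so is
  the drift. In the coefficients of the increments an index \<open>j\<close> or \<open>k\<close> collects one factor and its
  inverse, and so does the summation index \<open>l\<close>.\<close>
lemma same_overlap_system_scale:
  assumes S: "S \<in> carrier_mat N N" and T: "T \<in> carrier_mat N N" and TS: "T * S = 1\<^sub>m N"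
    and c: "\<forall>j<N. c j \<noteq> 0"
  shows "same_overlap_system N lam S (S * mat_diag N c)"
proof -
  define S' where "S' = S * mat_diag N c"
  define T' where "T' = mat_diag N (\<lambda>j. 1 / c j) * T"
  have S'c: "S' \<in> carrier_mat N N" and T'c: "T' \<in> carrier_mat N N"
    using S T by (auto simp: S'_def T'_def intro!: mult_carrier_mat)
  have TS': "T' * S' = 1\<^sub>m N" unfolding S'_def T'_def by (rule inverse_times_diag[OF S T TS c])
  have mS: "minv S = T" and mS': "minv S' = T'"
    using minv_eqI[OF S T TS] minv_eqI[OF S'c T'c TS'] .
  have Ss: "S' $$ (p, j) = S $$ (p, j) * c j" if "p < N" "j < N" for p j
    using that S by (simp add: S'_def mat_diag_mult_right)
  have Ts: "T' $$ (j, p) = T $$ (j, p) / c j" if "p < N" "j < N" for p j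
    using that T by (simp add: T'_def mat_diag_mult_left)
  have Ae: "gram U $$ (j, k) = (\<Sum>p<N. cnj (U $$ (p, j)) * U $$ (p, k))"
    if "U \<in> carrier_mat N N" "j < N" "k < N" for U j k
    using that mat_adjoint_carrier[of U N N]
    by (simp add: gram_def scalar_prod_def mat_adjoint_index atLeast0LessThan)
  have Be: "(U * mat_adjoint U) $$ (j, k) = (\<Sum>p<N. U $$ (j, p) * cnj (U $$ (k, p)))"
    if "U \<in> carrier_mat N N" "j < N" "k < N" for U j k
    using that mat_adjoint_carrier[of U N N]
    by (simp add: scalar_prod_def mat_adjoint_index atLeast0LessThan)
  have A: "gram S' $$ (j, k) = cnj (c j) * c k * gram S $$ (j, k)" if "j < N" "k < N" for j k
    using that by (simp add: Ae S S'c Ss sum_distrib_left mult_ac)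
  have B: "minv (gram S') $$ (j, k) = minv (gram S) $$ (j, k) / (c j * cnj (c k))"
    if "j < N" "k < N" for j k
    unfolding minv_gram[OF S T TS] minv_gram[OF S'c T'c TS']
    using that by (simp add: Be T T'c Ts sum_divide_distrib)
  have O: "overlap S' j k = overlap S j k" if "j < N" "k < N" for j k
    using that c by (simp add: overlap_def A B)
  have drift: "overlap_drift N lam S' j k = overlap_drift N lam S j k" if "j < N" "k < N" for j k
    unfolding overlap_drift_def using that
    by (intro arg_cong2[where f = "(*)"] refl sum.cong) (auto simp: O)
  have dM: "overlap_coeff_dM N lam S' j k p q = overlap_coeff_dM N lam S j k p q"
    if "j < N" "k < N" "p < N" "q < N" for j k p q
    unfolding overlap_coeff_dM_def Let_def mS mS'
  proof (intro sum.cong refl)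
    fix l assume "l \<in> {..<N} - {j}"
    then have l: "l < N" by simp
    have 1: "minv (gram S') $$ (j, k) * gram S' $$ (k, l) * (T' $$ (l, p) * S' $$ (q, j))
        = minv (gram S) $$ (j, k) * gram S $$ (k, l) * (T $$ (l, p) * S $$ (q, j))"
      using that l c by (simp add: A B Ss Ts)
    have 2: "gram S' $$ (k, j) * minv (gram S') $$ (l, k) * (T' $$ (j, p) * S' $$ (q, l))
        = gram S $$ (k, j) * minv (gram S) $$ (l, k) * (T $$ (j, p) * S $$ (q, l))"
      using that l c by (simp add: A B Ss Ts)
    show "(minv (gram S') $$ (j, k) * gram S' $$ (k, l) * (T' $$ (l, p) * S' $$ (q, j)) +
         gram S' $$ (k, j) * minv (gram S') $$ (l, k) * (T' $$ (j, p) * S' $$ (q, l))) / (lam j - lam l)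
      = (minv (gram S) $$ (j, k) * gram S $$ (k, l) * (T $$ (l, p) * S $$ (q, j)) +
         gram S $$ (k, j) * minv (gram S) $$ (l, k) * (T $$ (j, p) * S $$ (q, l))) / (lam j - lam l)"
      unfolding 1 2 ..
  qed
  have dMbar: "overlap_coeff_dMbar N lam S' j k p q = overlap_coeff_dMbar N lam S j k p q"
    if "j < N" "k < N" "p < N" "q < N" for j k p q
    unfolding overlap_coeff_dMbar_def Let_def mS mS'
  proof (intro sum.cong refl)
    fix l assume "l \<in> {..<N} - {k}"
    then have l: "l < N" by simp
    have 1: "minv (gram S') $$ (j, k) * gram S' $$ (l, j) * cnj (T' $$ (l, p) * S' $$ (q, k))
        = minv (gram S) $$ (j, k) * gram S $$ (l, j) * cnj (T $$ (l, p) * S $$ (q, k))"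
      using that l c by (simp add: A B Ss Ts)
    have 2: "gram S' $$ (k, j) * minv (gram S') $$ (j, l) * cnj (T' $$ (k, p) * S' $$ (q, l))
        = gram S $$ (k, j) * minv (gram S) $$ (j, l) * cnj (T $$ (k, p) * S $$ (q, l))"
      using that l c by (simp add: A B Ss Ts)
    show "(minv (gram S') $$ (j, k) * gram S' $$ (l, j) * cnj (T' $$ (l, p) * S' $$ (q, k)) +
         gram S' $$ (k, j) * minv (gram S') $$ (j, l) * cnj (T' $$ (k, p) * S' $$ (q, l))) /
         (cnj (lam k) - cnj (lam l))
      = (minv (gram S) $$ (j, k) * gram S $$ (l, j) * cnj (T $$ (l, p) * S $$ (q, k)) +
         gram S $$ (k, j) * minv (gram S) $$ (j, l) * cnj (T $$ (k, p) * S $$ (q, l))) /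
         (cnj (lam k) - cnj (lam l))"
      unfolding 1 2 ..
  qed
  show ?thesis
    using O drift dM dMbar unfolding same_overlap_system_def S'_def by metis
qed

lemma biorthogonal_carrier:
  assumes "A \<in> carrier_mat N N" "biorthogonal_eigenvectors N A lam r l" "j < N"
  shows "r j \<in> carrier_vec N" "l j \<in> carrier_vec N"
  using assms by (auto simp: biorthogonal_eigenvectors_def eigenvector_def)

lemma biorthogonal_inverse:
  assumes "A \<in> carrier_mat N N" "biorthogonal_eigenvectors N A lam r l"
  shows "mat_of_rows N (map l [0..<N]) * eigenvector_matrix N r = 1\<^sub>m N"
  using assms biorthogonal_carrier[OF assms]
  by (intro eq_matI) (auto simp: eigenvector_matrix_def biorthogonal_eigenvectors_def)

lemma same_overlap_system_eigenvectors_scale: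
  assumes "A \<in> carrier_mat N N" "biorthogonal_eigenvectors N A lam r l" "\<forall>j<N. c j \<noteq> 0"
  shows "same_overlap_system N lam' (eigenvector_matrix N r) (eigenvector_matrix N r * mat_diag N c)"
  by (rule same_overlap_system_scale[OF _ _ biorthogonal_inverse[OF assms(1,2)] assms(3)])
    (auto simp: eigenvector_matrix_def mat_of_cols_def mat_of_rows_def)

lemma eigenvector_matrix_scale:
  assumes "\<forall>j<N. r j \<in> carrier_vec N"
  shows "eigenvector_matrix N (\<lambda>j. c j \<cdot>\<^sub>v r j) = eigenvector_matrix N r * mat_diag N c"
proof -
  have S: "eigenvector_matrix N r \<in> carrier_mat N N"
    by (auto simp: eigenvector_matrix_def mat_of_cols_def)
  show ?thesis
    unfolding mat_diag_mult_right[OF S]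
    using assms by (intro eq_matI) (auto simp: eigenvector_matrix_def mat_of_cols_def)
qed

lemma biorthogonal_eigenvectors_scale:
  assumes A: "A \<in> carrier_mat N N" and b: "biorthogonal_eigenvectors N A lam r l"
    and c: "\<forall>j<N. c j \<noteq> 0"
  shows "biorthogonal_eigenvectors N A lam (\<lambda>j. c j \<cdot>\<^sub>v r j) (\<lambda>j. (1 / c j) \<cdot>\<^sub>v l j)"
proof -
  have ev: "eigenvector X (a \<cdot>\<^sub>v v) z"
    if X: "X \<in> carrier_mat N N" and e: "eigenvector X v z" and a: "a \<noteq> 0"
    for X v z and a :: complex
  proof -
    have v: "v \<in> carrier_vec N" "v \<noteq> 0\<^sub>v N" "X *\<^sub>v v = z \<cdot>\<^sub>v v" using e X by (auto simp: eigenvector_def)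
    have "a \<cdot>\<^sub>v v \<noteq> 0\<^sub>v N"
    proof
      assume "a \<cdot>\<^sub>v v = 0\<^sub>v N"
      then have "(1 / a) \<cdot>\<^sub>v (a \<cdot>\<^sub>v v) = 0\<^sub>v N" by (simp only:) (intro eq_vecI; simp)
      then show False using a v by (simp add: smult_smult_assoc)
    qed
    moreover have "X *\<^sub>v (a \<cdot>\<^sub>v v) = z \<cdot>\<^sub>v (a \<cdot>\<^sub>v v)"
      using mult_mat_vec[OF X v(1), of a] v(3) by (simp add: smult_smult_assoc mult.commute)
    ultimately show ?thesis using v X by (auto simp: eigenvector_def)
  qed
  have AT: "transpose_mat A \<in> carrier_mat N N" using A by simp
  note car = biorthogonal_carrier[OF A b]
  have "((1 / c j) \<cdot>\<^sub>v l j) \<bullet> (c k \<cdot>\<^sub>v r k) = (1 / c j) * (c k * (l j \<bullet> r k))" if "j < N" "k < N" for j k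
    using smult_scalar_prod_distrib[OF car(2)[OF that(1)] smult_carrier_vec[THEN iffD2, OF car(1)[OF that(2)]]]
      scalar_prod_smult_distrib[OF car(2)[OF that(1)] car(1)[OF that(2)]] by simp
  then show ?thesis
    using b c ev[OF A] ev[OF AT]
    by (auto simp: biorthogonal_eigenvectors_def)
qed

section \<open>Uniqueness of the eigenvectors up to scaling\<close>

text \<open>The pairing of a left eigenvector with a right eigenvector for a different eigenvalue is zero. So
  if the eigenvalues are distinct, the expansion of \<open>r' j\<close> in the basis \<open>r\<close>, whose coefficients are
  the pairings with the \<open>l k\<close>, consists of the single term \<open>k = j\<close>.\<close>
lemma biorthogonal_eigenvectors_unique:
  assumes A: "A \<in> carrier_mat N N" and inj: "inj_on lam {..<N}"
    and b: "biorthogonal_eigenvectors N A lam r l" and b': "biorthogonal_eigenvectors N A lam r' l'"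
  obtains c where "\<forall>j<N. c j \<noteq> 0" "\<forall>j<N. r' j = c j \<cdot>\<^sub>v r j"
proof
  let ?c = "\<lambda>j. l j \<bullet> r' j"
  let ?S = "eigenvector_matrix N r" and ?T = "mat_of_rows N (map l [0..<N])"
  have S: "?S \<in> carrier_mat N N" and T: "?T \<in> carrier_mat N N"
    by (auto simp: eigenvector_matrix_def mat_of_cols_def mat_of_rows_def)
  have ST: "?S * ?T = 1\<^sub>m N"
    using mat_mult_left_right_inverse[OF T S biorthogonal_inverse[OF A b]] .
  note car = biorthogonal_carrier[OF A b] biorthogonal_carrier[OF A b']
  have zero: "l k \<bullet> r' j = 0" if jk: "j < N" "k < N" "j \<noteq> k" for j k
  proof -
    have "transpose_mat A *\<^sub>v l k = lam k \<cdot>\<^sub>v l k" "A *\<^sub>v r' j = lam j \<cdot>\<^sub>v r' j"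
      using b b' jk by (auto simp: biorthogonal_eigenvectors_def eigenvector_def)
    then have "lam k * (l k \<bullet> r' j) = lam j * (l k \<bullet> r' j)"
      using transpose_vec_mult_scalar[OF A car(3)[OF jk(1)] car(2)[OF jk(2)]]
        smult_scalar_prod_distrib[OF car(2)[OF jk(2)] car(3)[OF jk(1)]]
        scalar_prod_smult_distrib[OF car(2)[OF jk(2)] car(3)[OF jk(1)]] by simp
    then show ?thesis using inj jk by (auto simp: inj_on_def)
  qed
  show eq: "\<forall>j<N. r' j = ?c j \<cdot>\<^sub>v r j"
  proof (intro allI impI)
    fix j assume j: "j < N"
    have "?T *\<^sub>v r' j = ?T *\<^sub>v (?c j \<cdot>\<^sub>v r j)"
      using b j car zero
      by (intro eq_vecI)
        (auto simp: biorthogonal_eigenvectors_def scalar_prod_smult_distrib[OF car(2,1)])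
    then have "?S *\<^sub>v (?T *\<^sub>v r' j) = ?S *\<^sub>v (?T *\<^sub>v (?c j \<cdot>\<^sub>v r j))" by simp
    then show "r' j = ?c j \<cdot>\<^sub>v r j"
      using car j assoc_mult_mat_vec[OF S T, symmetric] ST by simp
  qed
  show "\<forall>j<N. ?c j \<noteq> 0"
  proof (intro allI impI notI)
    fix j assume j: "j < N" and "?c j = 0"
    then have "r' j = 0 \<cdot>\<^sub>v r j" using eq by metis
    then have "r' j = 0\<^sub>v N" using car(1)[OF j] by (simp only:) (intro eq_vecI; simp)
    then show False
      using b' j A by (auto simp: biorthogonal_eigenvectors_def eigenvector_def)
  qed
qed

section \<open>Diagonalizable matrices with a repeated eigenvalue\<close>

text \<open>The general matrix \<open>B + z\<close> for which the columns \<open>a\<close> and \<open>b\<close> of \<open>B\<close> are combinations of the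
  other columns of \<open>B\<close>. All parameters are packed into one \<open>N \<times> N\<close> array \<open>w\<close>, which makes them
  easy to count: the columns other than \<open>a\<close> and \<open>b\<close> hold those of \<open>B\<close>, the
  columns \<open>a\<close> and \<open>b\<close> hold the coefficients of the two combinations (in the rows other than \<open>a\<close> and
  \<open>b\<close>), and \<open>w (a, a)\<close> is \<open>z\<close>. The value does not depend on the three positions
  \<open>(a, b)\<close>, \<open>(b, a)\<close>, \<open>(b, b)\<close>.\<close>
definition degenerate_entry :: "nat \<Rightarrow> nat \<Rightarrow> nat \<Rightarrow> (nat \<times> nat \<Rightarrow> complex) \<Rightarrow> nat \<times> nat \<Rightarrow> complex" where
  "degenerate_entry N a b w = (\<lambda>(p, k).
     (if k = a \<or> k = b then \<Sum>m\<in>{..<N} - {a, b}. w (m, k) * w (p, m) else w (p, k)) +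
     (if p = k then w (a, a) else 0))"

lemma exists_nonzero_minor:
  fixes x y :: "complex Matrix.vec"
  assumes x: "x \<in> carrier_vec N" "x \<noteq> 0\<^sub>v N" and y: "y \<in> carrier_vec N"
    and ind: "\<And>s. y \<noteq> s \<cdot>\<^sub>v x"
  obtains a b where "a < N" "b < N" "x $ a * y $ b - x $ b * y $ a \<noteq> 0"
proof -
  obtain a where a: "a < N" "x $ a \<noteq> 0"
    using x by (metis carrier_vecD eq_vecI index_zero_vec)
  have "y \<noteq> (y $ a / x $ a) \<cdot>\<^sub>v x" by (rule ind)
  then obtain b where "b < N" "y $ b \<noteq> y $ a / x $ a * x $ b"
    using x(1) y by (metis carrier_vecD eq_vecI index_smult_vec)
  then show thesis using that[of a b] a by (simp add: field_simps)
qed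

text \<open>Two independent eigenvectors for the same eigenvalue have a nonzero \<open>2 \<times> 2\<close> minor, in rows
  \<open>a\<close> and \<open>c\<close> say. Their span then contains vectors \<open>v\<close> and \<open>w\<close> whose entries in these two rows
  are \<open>(1, 0)\<close> and \<open>(0, 1)\<close>; as kernel vectors of \<open>A - z\<close> they express its columns \<open>a\<close> and
  \<open>c\<close> in terms of the others.\<close>
lemma degenerate_parametrisation:
  assumes A: "A \<in> carrier_mat N N" and b: "biorthogonal_eigenvectors N A lam r l"
    and jk: "j < N" "k < N" "j \<noteq> k" "lam j = lam k"
  shows "\<exists>a b w. a < N \<and> b < N \<and> a \<noteq> b \<and> (\<forall>p<N. \<forall>q<N. A $$ (p, q) = degenerate_entry N a b w (p, q))"
proof -
  let ?z = "lam j"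
  note car = biorthogonal_carrier[OF A b]
  have eig: "(\<Sum>m<N. A $$ (p, m) * v $ m) = ?z * v $ p"
    if "v = r j \<or> v = r k" "p < N" for v p
  proof -
    have "A *\<^sub>v v = ?z \<cdot>\<^sub>v v" and v: "v \<in> carrier_vec N"
      using that b jk car by (auto simp: biorthogonal_eigenvectors_def eigenvector_def)
    then have "(A *\<^sub>v v) $ p = ?z * v $ p" using that by simp
    then show ?thesis using that v A by (simp add: scalar_prod_def atLeast0LessThan)
  qed
  have "r k \<noteq> s \<cdot>\<^sub>v r j" for s
  proof
    assume "r k = s \<cdot>\<^sub>v r j"
    then have "l k \<bullet> r k = s * (l k \<bullet> r j)"
      using scalar_prod_smult_distrib[OF car(2)[OF jk(2)] car(1)[OF jk(1)]] by simp
    then show False using b jk by (simp add: biorthogonal_eigenvectors_def)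
  qed
  moreover have "r j \<noteq> 0\<^sub>v N" using b jk A by (auto simp: biorthogonal_eigenvectors_def eigenvector_def)
  ultimately obtain a c where ac: "a < N" "c < N" "r j $ a * r k $ c - r j $ c * r k $ a \<noteq> 0"
    using exists_nonzero_minor[of "r j" N "r k"] car jk by metis
  let ?\<Delta> = "r j $ a * r k $ c - r j $ c * r k $ a"
  have anc: "a \<noteq> c" using ac(3) by auto
  define v where "v m = (r k $ c * r j $ m - r j $ c * r k $ m) / ?\<Delta>" for m
  define w where "w m = (r j $ a * r k $ m - r k $ a * r j $ m) / ?\<Delta>" for m
  have vw: "v a = 1" "v c = 0" "w a = 0" "w c = 1"
    using ac(3) by (simp_all add: v_def w_def mult.commute)
  have comb: "(\<Sum>m<N. A $$ (p, m) * ((s * r j $ m - t * r k $ m) / d)) = ?z * ((s * r j $ p - t * r k $ p) / d)"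
    if p: "p < N" for p s t d
  proof -
    have "(\<Sum>m<N. A $$ (p, m) * ((s * r j $ m - t * r k $ m) / d))
      = (s * (\<Sum>m<N. A $$ (p, m) * r j $ m) - t * (\<Sum>m<N. A $$ (p, m) * r k $ m)) / d"
      by (simp add: sum_distrib_left sum_subtractf[symmetric] sum_divide_distrib algebra_simps diff_divide_distrib)
    also have "\<dots> = ?z * ((s * r j $ p - t * r k $ p) / d)"
      using eig p by (simp add: algebra_simps)
    finally show ?thesis .
  qed
  have Av: "(\<Sum>m<N. A $$ (p, m) * v m) = ?z * v p" if "p < N" for p
    unfolding v_def by (rule comb[OF that])
  have Aw: "(\<Sum>m<N. A $$ (p, m) * w m) = ?z * w p" if "p < N" for p
    using comb[OF that, of "- r k $ a" "- r j $ a" ?\<Delta>] by (simp add: w_def)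
  have split: "(\<Sum>m<N. f m) = f a + f c + (\<Sum>m\<in>{..<N} - {a, c}. f m)" for f :: "nat \<Rightarrow> complex"
  proof -
    have "(\<Sum>m<N. f m) = (\<Sum>m\<in>{a, c}. f m) + (\<Sum>m\<in>{..<N} - {a, c}. f m)"
      using ac by (subst sum.subset_diff[of "{a, c}"]) auto
    then show ?thesis using anc by simp
  qed
  define u where "u = (\<lambda>(p, m). if m = a then (if p = a then ?z else - v p)
    else if m = c then - w p else A $$ (p, m) - (if p = m then ?z else 0))"
  have colsum: "(\<Sum>m\<in>{..<N} - {a, c}. - x m * (A $$ (p, m) - (if p = m then ?z else 0)))
      = x a * (A $$ (p, a) - (if p = a then ?z else 0)) + x c * (A $$ (p, c) - (if p = c then ?z else 0))"
    if x: "(\<Sum>m<N. A $$ (p, m) * x m) = ?z * x p" and p: "p < N" for x p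
  proof -
    have "(\<Sum>m<N. x m * (A $$ (p, m) - (if p = m then ?z else 0)))
        = (\<Sum>m<N. A $$ (p, m) * x m) - (\<Sum>m<N. if m = p then ?z * x m else 0)"
      unfolding sum_subtractf[symmetric] by (intro sum.cong) (auto simp: algebra_simps)
    also have "\<dots> = 0" using x p by simp
    finally have "x a * (A $$ (p, a) - (if p = a then ?z else 0)) + x c * (A $$ (p, c) - (if p = c then ?z else 0))
        = - (\<Sum>m\<in>{..<N} - {a, c}. x m * (A $$ (p, m) - (if p = m then ?z else 0)))"
      unfolding split by (simp only: eq_neg_iff_add_eq_0)
    then show ?thesis
      by (simp only: mult_minus_left sum_negf)
  qed
  have "A $$ (p, q) = degenerate_entry N a c u (p, q)" if pq: "p < N" "q < N" for p q
  proof -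
    consider "q = a" | "q = c" | "q \<noteq> a" "q \<noteq> c" by blast
    then show ?thesis
    proof cases
      case 1
      have "(\<Sum>m\<in>{..<N} - {a, c}. u (m, a) * u (p, m))
        = (\<Sum>m\<in>{..<N} - {a, c}. - v m * (A $$ (p, m) - (if p = m then ?z else 0)))"
        by (intro sum.cong) (auto simp: u_def)
      also have "\<dots> = A $$ (p, a) - (if p = a then ?z else 0)"
        using colsum[OF Av pq(1)] pq vw by simp
      finally show ?thesis using 1 by (simp add: degenerate_entry_def) (simp add: u_def)
    next
      case 2
      have "(\<Sum>m\<in>{..<N} - {a, c}. u (m, c) * u (p, m))
        = (\<Sum>m\<in>{..<N} - {a, c}. - w m * (A $$ (p, m) - (if p = m then ?z else 0)))"
        using anc by (intro sum.cong) (auto simp: u_def)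
      also have "\<dots> = A $$ (p, c) - (if p = c then ?z else 0)"
        using colsum[OF Aw pq(1)] pq vw by simp
      finally show ?thesis using 2 by (simp add: degenerate_entry_def) (simp add: u_def)
    next
      case 3
      then show ?thesis by (simp add: degenerate_entry_def) (simp add: u_def)
    qed
  qed
  then show ?thesis using ac anc by blast
qed

lemma degenerate_entry_lipschitz:
  assumes ab: "a < N" "b < N" "a \<noteq> b" and pq: "p < N" "q < N" and K: "0 \<le> K" "0 \<le> e"
    and x: "\<forall>i\<in>{..<N} \<times> {..<N} - {(a, b), (b, a), (b, b)}. cmod (x i) \<le> K \<and> cmod (y i) \<le> K \<and> cmod (x i - y i) \<le> e"
  shows "cmod (degenerate_entry N a b x (p, q) - degenerate_entry N a b y (p, q)) \<le> (2 * real N * K + 2) * e"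
proof -
  have x': "cmod (x (i, m)) \<le> K" "cmod (y (i, m)) \<le> K" "cmod (x (i, m) - y (i, m)) \<le> e"
    if "i < N" "m < N" "(i, m) \<notin> {(a, b), (b, a), (b, b)}" for i m
    using x that by auto
  have diag: "cmod (x (a, a) - y (a, a)) \<le> e" using x'(3)[of a a] ab by auto
  have prod: "cmod (x (m, q) * x (p, m) - y (m, q) * y (p, m)) \<le> 2 * K * e"
    if m: "m \<in> {..<N} - {a, b}" and q: "q = a \<or> q = b" for m
  proof -
    have mq: "cmod (x (m, q)) \<le> K" "cmod (x (m, q) - y (m, q)) \<le> e" using x'[of m q] m q pq by auto
    have pm: "cmod (y (p, m)) \<le> K" "cmod (x (p, m) - y (p, m)) \<le> e" using x'[of p m] m pq by auto
    have "x (m, q) * x (p, m) - y (m, q) * y (p, m)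
        = x (m, q) * (x (p, m) - y (p, m)) + (x (m, q) - y (m, q)) * y (p, m)"
      by (simp add: algebra_simps)
    also have "cmod \<dots> \<le> K * e + e * K"
      by (intro norm_triangle_mono) (auto simp: norm_mult intro!: mult_mono mq pm K)
    finally show ?thesis by (simp add: mult_ac)
  qed
  let ?f = "\<lambda>x. if q = a \<or> q = b then \<Sum>m\<in>{..<N} - {a, b}. x (m, q) * x (p, m) else x (p, q)"
  have f: "cmod (?f x - ?f y) \<le> (2 * real N * K + 1) * e"
  proof (cases "q = a \<or> q = b")
    case True
    have "cmod (\<Sum>m\<in>{..<N} - {a, b}. x (m, q) * x (p, m) - y (m, q) * y (p, m)) \<le> (\<Sum>m\<in>{..<N} - {a, b}. 2 * K * e)"
      using prod True by (intro sum_norm_le) auto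
    also have "\<dots> \<le> real N * (2 * K * e)"
      using K card_mono[of "{..<N}" "{..<N} - {a, b}"] by (auto intro!: mult_right_mono)
    also have "\<dots> \<le> (2 * real N * K + 1) * e" using K by (simp add: algebra_simps)
    finally show ?thesis using True by (simp add: sum_subtractf)
  next
    case False
    have "cmod (x (p, q) - y (p, q)) \<le> e" using x'(3)[of p q] pq False by auto
    also have "\<dots> \<le> (2 * real N * K + 1) * e" using K by (simp add: algebra_simps)
    finally show ?thesis using False by simp
  qed
  have "degenerate_entry N a b x (p, q) - degenerate_entry N a b y (p, q)
      = (?f x - ?f y) + (if p = q then x (a, a) - y (a, a) else 0)"
    by (simp add: degenerate_entry_def)
  also have "cmod \<dots> \<le> (2 * real N * K + 1) * e + e"
    by (rule norm_triangle_mono[OF f]) (use diag K in auto)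
  finally show ?thesis by (simp add: algebra_simps)
qed

section \<open>The modulus of continuity of Brownian motion\<close>

lemma normal_small_ball:
  assumes "prob_space P" "distributed P lborel X (normal_density 0 (sqrt h))" "0 < h" "0 \<le> c"
  shows "measure P {\<omega> \<in> space P. \<bar>X \<omega> - y\<bar> \<le> c} \<le> 2 * c / sqrt h"
proof -
  interpret prob_space P by fact
  have le: "normal_density 0 (sqrt h) x \<le> 1 / sqrt h" for x
  proof -
    have "normal_density 0 (sqrt h) x \<le> 1 / sqrt (2 * pi * h)"
    proof -
      have "exp (- (x\<^sup>2 / (2 * h))) \<le> 1" using assms(3) by simp
      then have "1 / sqrt (2 * pi * h) * exp (- (x\<^sup>2 / (2 * h))) \<le> 1 / sqrt (2 * pi * h) * 1"
        by (intro mult_left_mono) (use assms(3) in auto)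
      then show ?thesis using assms(3) by (simp add: normal_density_def)
    qed
    also have "\<dots> \<le> 1 / sqrt h"
      using assms(3) pi_gt3 by (intro divide_left_mono) (auto simp: mult_le_cancel_right1)
    finally show ?thesis .
  qed
  have eq: "{\<omega> \<in> space P. \<bar>X \<omega> - y\<bar> \<le> c} = X -` {y - c..y + c} \<inter> space P"
    by (auto simp: abs_le_iff algebra_simps)
  have "emeasure P (X -` {y - c..y + c} \<inter> space P)
      = (\<integral>\<^sup>+ x. ennreal (normal_density 0 (sqrt h) x) * indicator {y - c..y + c} x \<partial>lborel)"
    using distributed_emeasure[OF assms(2), of "{y - c..y + c}"] by simp
  also have "\<dots> \<le> (\<integral>\<^sup>+ x. ennreal (1 / sqrt h) * indicator {y - c..y + c} x \<partial>lborel)"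
    by (intro nn_integral_mono mult_right_mono ennreal_leI le) auto
  also have "\<dots> = ennreal (2 * c / sqrt h)"
    using assms(3,4) by (simp add: nn_integral_cmult ennreal_mult[symmetric])
  finally show ?thesis
    unfolding eq using assms(3,4) by (simp add: emeasure_eq_measure)
qed

text \<open>Markov's inequality for the fourth power. The second moment would lose the
  factor \<open>h\<close> that makes up for the \<open>1 / h\<close> increments of length \<open>h\<close> in the union bound.\<close>
lemma normal_fourth_moment_tail:
  assumes "prob_space P" "distributed P lborel X (normal_density 0 (sqrt h))" "0 < h" "0 < x"
  shows "measure P {\<omega> \<in> space P. x \<le> \<bar>X \<omega>\<bar>} \<le> 3 * h\<^sup>2 / x ^ 4"
proof -
  interpret prob_space P by fact
  have sigma: "0 < sqrt h" using assms(3) by simp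
  have mom: "has_bochner_integral lborel (\<lambda>x. normal_density 0 (sqrt h) x * x ^ 4) (3 * h\<^sup>2)"
    using normal_moment_even[OF sigma, of 0 2] assms(3)
    by (simp add: fact_numeral power_divide field_simps)
  have int: "integrable P (\<lambda>\<omega>. X \<omega> ^ 4)"
    using distributed_integrable[OF assms(2), of "\<lambda>x. x ^ 4"] mom
    by (auto simp: has_bochner_integral_iff)
  have val: "(\<integral>\<omega>. X \<omega> ^ 4 \<partial>P) = 3 * h\<^sup>2"
    using distributed_integral[OF assms(2), of "\<lambda>x. x ^ 4"] mom
    by (auto simp: has_bochner_integral_iff)
  have eq: "{\<omega> \<in> space P. x \<le> \<bar>X \<omega>\<bar>} = {\<omega> \<in> space P. x ^ 4 \<le> X \<omega> ^ 4}"
    using assms(4) power_mono_iff[of x "\<bar>X _\<bar>" 4] by auto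
  show ?thesis
    unfolding eq val[symmetric]
    using integral_Markov_inequality_measure[OF int, of "{}" "x ^ 4"] assms(4) by simp
qed

text \<open>The dyadic approximation of \<open>t\<close> from below moves by at most one step of length \<open>1 / 2 ^ m\<close> when the
  level increases to \<open>m\<close>, so the difference telescopes into a geometric series.\<close>
lemma dyadic_chaining:
  fixes f :: "real \<Rightarrow> real"
  assumes cont: "continuous_on {0..} f" and \<theta>: "0 \<le> \<theta>" "\<theta> < 1"
    and inc: "\<And>m k. n \<le> m \<Longrightarrow> k < T * 2 ^ m \<Longrightarrow>
        \<bar>f (real (Suc k) / 2 ^ m) - f (real k / 2 ^ m)\<bar> \<le> \<theta> ^ m"
    and t: "0 \<le> t" "t \<le> real T"
  shows "\<bar>f t - f (real (nat \<lfloor>2 ^ n * t\<rfloor>) / 2 ^ n)\<bar> \<le> \<theta> ^ n * (\<theta> / (1 - \<theta>))"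
proof -
  define d where "d m = nat \<lfloor>2 ^ m * t\<rfloor>" for m :: nat
  let ?g = "\<lambda>m. f (real (d m) / 2 ^ m)"
  have d: "real (d m) \<le> 2 ^ m * t" "2 ^ m * t < real (d m) + 1" for m
    using t(1) by (auto simp: d_def)
  have dS: "d (Suc m) = 2 * d m \<or> d (Suc m) = Suc (2 * d m)" for m
  proof -
    have "real (d (Suc m)) < 2 * real (d m) + 2" "2 * real (d m) < real (d (Suc m)) + 1"
      using d[of m] d[of "Suc m"] by auto
    then show ?thesis by linarith
  qed
  have half: "real (2 * k) / 2 ^ Suc m = real k / 2 ^ m" for k m by simp
  have step: "\<bar>?g (Suc m) - ?g m\<bar> \<le> \<theta> ^ Suc m" if "n \<le> m" for m
  proof (cases "d (Suc m) = 2 * d m")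
    case True
    then show ?thesis using \<theta> half[of "d m" m] by simp
  next
    case False
    then have e: "d (Suc m) = Suc (2 * d m)" using dS by blast
    have "real (d (Suc m)) \<le> 2 ^ Suc m * real T"
      by (rule order_trans[OF d(1)]) (use t in auto)
    then have "real (d (Suc m)) \<le> real (T * 2 ^ Suc m)" by (simp add: mult.commute)
    then have "2 * d m < T * 2 ^ Suc m" unfolding of_nat_le_iff e by simp
    from inc[OF _ this] show ?thesis using that unfolding e half by simp
  qed
  have tele: "\<bar>?g (n + i) - ?g n\<bar> \<le> \<theta> ^ n * (\<theta> / (1 - \<theta>)) * (1 - \<theta> ^ i)" for i
  proof (induction i)
    case (Suc i)
    have "\<bar>?g (n + Suc i) - ?g n\<bar> \<le> \<theta> ^ Suc (n + i) + \<theta> ^ n * (\<theta> / (1 - \<theta>)) * (1 - \<theta> ^ i)"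
      using Suc step[of "n + i"] by simp
    also have "\<dots> = \<theta> ^ n * (\<theta> / (1 - \<theta>)) * (1 - \<theta> ^ Suc i)"
      using \<theta> by (simp add: field_simps power_add)
    finally show ?case .
  qed simp
  have lim: "(\<lambda>m. real (d m) / 2 ^ m) \<longlonglongrightarrow> t"
  proof (rule tendsto_sandwich)
    show "\<forall>\<^sub>F m in sequentially. t - (1 / 2) ^ m \<le> real (d m) / 2 ^ m"
    proof (intro always_eventually allI)
      fix m :: nat
      have "t - (1 / 2) ^ m = (2 ^ m * t - 1) / 2 ^ m"
        by (simp add: diff_divide_distrib power_divide)
      also have "\<dots> \<le> real (d m) / 2 ^ m"
        by (rule divide_right_mono) (use d(2)[of m] in auto)
      finally show "t - (1 / 2) ^ m \<le> real (d m) / 2 ^ m" .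
    qed
    show "\<forall>\<^sub>F m in sequentially. real (d m) / 2 ^ m \<le> t"
    proof (intro always_eventually allI)
      fix m :: nat
      show "real (d m) / 2 ^ m \<le> t" using d(1)[of m] by (simp add: field_simps)
    qed
    have "(\<lambda>m. (1 / 2 :: real) ^ m) \<longlonglongrightarrow> 0" by (rule LIMSEQ_power_zero) simp
    from tendsto_diff[OF tendsto_const this, of t]
    show "(\<lambda>m. t - (1 / 2 :: real) ^ m) \<longlonglongrightarrow> t" by simp
  qed simp
  have "?g \<longlonglongrightarrow> f t"
    by (rule continuous_on_tendsto_compose[OF cont lim]) (use t in auto)
  then have "(\<lambda>i. ?g (n + i)) \<longlonglongrightarrow> f t"
    unfolding add.commute[of n] by (rule LIMSEQ_ignore_initial_segment)
  then have "(\<lambda>i. \<bar>?g (n + i) - ?g n\<bar>) \<longlonglongrightarrow> \<bar>f t - ?g n\<bar>"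
    by (intro tendsto_intros)
  moreover have "\<bar>?g (n + i) - ?g n\<bar> \<le> \<theta> ^ n * (\<theta> / (1 - \<theta>))" for i
  proof -
    have "\<theta> ^ n * (\<theta> / (1 - \<theta>)) * (1 - \<theta> ^ i) \<le> \<theta> ^ n * (\<theta> / (1 - \<theta>)) * 1"
      using \<theta> by (intro mult_left_mono) auto
    then show ?thesis using tele[of i] by linarith
  qed
  ultimately have "\<bar>f t - ?g n\<bar> \<le> \<theta> ^ n * (\<theta> / (1 - \<theta>))"
    by (intro LIMSEQ_le_const2) auto
  then show ?thesis by (simp add: d_def)
qed

text \<open>By the fourth moment bound, the expected number of increments over dyadic intervals of level \<open>n\<close> that
  exceed \<open>(7 / 8) ^ n\<close> is \<open>O((2 \<theta> ^ 4) powr - n)\<close> with \<open>\<theta> = 7 / 8\<close>, where \<open>1 / (2 \<theta> ^ 4) = 2048 / 2401\<close>.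
  So by Borel and Cantelli the hypothesis of \<open>dyadic_chaining\<close> holds from some level on. The
  factor \<open>7\<close> is \<open>\<theta> / (1 - \<theta>)\<close>.\<close>
lemma brownian_dyadic_modulus:
  assumes P: "prob_space P" and W: "standard_brownian_motion P F W"
  shows "AE \<omega> in P. \<forall>\<^sub>F n in sequentially. \<forall>t. 0 \<le> t \<and> t \<le> real T \<longrightarrow>
    \<bar>W t \<omega> - W (real (nat \<lfloor>2 ^ n * t\<rfloor>) / 2 ^ n) \<omega>\<bar> \<le> 7 * (7 / 8) ^ n"
proof -
  interpret prob_space P by fact
  define X where "X n k \<omega> = W (real (Suc k) / 2 ^ n) \<omega> - W (real k / 2 ^ n) \<omega>" for n k :: nat and \<omega>
  have X: "distributed P lborel (X n k) (normal_density 0 (sqrt (1 / 2 ^ n)))" for n k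
  proof -
    have "real (Suc k) / 2 ^ n - real k / 2 ^ n = 1 / 2 ^ n" by (simp add: field_simps)
    moreover have "0 \<le> real k / 2 ^ n \<and> real k / 2 ^ n < real (Suc k) / 2 ^ n"
      by (simp add: divide_strict_right_mono)
    ultimately show ?thesis
      using W unfolding standard_brownian_motion_def X_def by metis
  qed
  have Xm [measurable]: "X n k \<in> borel_measurable P" for n k
    using distributed_measurable[OF X] by simp
  define A where "A n = (\<Union>k<T * 2 ^ n. {\<omega> \<in> space P. (7 / 8) ^ n \<le> \<bar>X n k \<omega>\<bar>})" for n :: nat
  have Am [measurable]: "A n \<in> sets P" for n unfolding A_def by measurable
  have "measure P (A n) \<le> 3 * real T * (2048 / 2401) ^ n" for n
  proof -
    have "measure P (A n) \<le> (\<Sum>k<T * 2 ^ n. measure P {\<omega> \<in> space P. (7 / 8) ^ n \<le> \<bar>X n k \<omega>\<bar>})"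
      unfolding A_def by (rule finite_measure_subadditive_finite) auto
    also have "\<dots> \<le> (\<Sum>k<T * 2 ^ n. 3 * (1 / 2 ^ n)\<^sup>2 / ((7 / 8) ^ n) ^ 4)"
      by (intro sum_mono normal_fourth_moment_tail[OF P X]) auto
    also have "\<dots> = 3 * real T * (2 ^ n * (1 / 2 ^ n)\<^sup>2 / ((7 / 8) ^ n) ^ 4)" by simp
    also have "2 ^ n * (1 / 2 ^ n)\<^sup>2 / ((7 / 8) ^ n) ^ 4 = (2 * (1 / 2)\<^sup>2 / (7 / 8) ^ 4 :: real) ^ n"
      by (simp only: power_divide power_mult_distrib power_mult[symmetric] power_one mult.commute)
    also have "(2 * (1 / 2)\<^sup>2 / (7 / 8) ^ 4 :: real) = 2048 / 2401" by (simp add: power_divide)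
    finally show ?thesis .
  qed
  moreover have "summable (\<lambda>n. 3 * real T * (2048 / 2401) ^ n)"
    by (intro summable_mult summable_geometric) simp
  ultimately have "summable (\<lambda>n. measure P (A n))"
    using summable_comparison_test'[of "\<lambda>n. 3 * real T * (2048 / 2401) ^ n" 0 "\<lambda>n. measure P (A n)"] by simp
  then have "AE \<omega> in P. \<forall>\<^sub>F n in sequentially. \<omega> \<in> space P - A n"
    by (rule borel_cantelli_AE1[rotated 2]) (auto simp: emeasure_eq_measure)
  moreover have "AE \<omega> in P. continuous_on {0..} (\<lambda>t. W t \<omega>)"
    using W by (simp add: standard_brownian_motion_def)
  ultimately show ?thesis
  proof eventually_elim
    case (elim \<omega>)
    then obtain n0 where n0: "\<And>m. n0 \<le> m \<Longrightarrow> \<omega> \<in> space P - A m"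
      by (auto simp: eventually_sequentially)
    have inc: "\<bar>W (real (Suc k) / 2 ^ m) \<omega> - W (real k / 2 ^ m) \<omega>\<bar> \<le> (7 / 8) ^ m"
      if "n0 \<le> m" "k < T * 2 ^ m" for m k
      using n0[OF that(1)] that(2) by (auto simp: A_def X_def not_le intro: less_imp_le)
    show ?case
      unfolding eventually_sequentially
    proof (intro exI[of _ n0] allI impI)
      fix n t assume "n0 \<le> n" "0 \<le> t \<and> t \<le> real T"
      then show "\<bar>W t \<omega> - W (real (nat \<lfloor>2 ^ n * t\<rfloor>) / 2 ^ n) \<omega>\<bar> \<le> 7 * (7 / 8) ^ n"
        using dyadic_chaining[of "\<lambda>t. W t \<omega>" "7 / 8" n T t] elim(2) inc by auto
    qed
  qed
qed

section \<open>Lipschitz images of codimension six are polar\<close>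

text \<open>The increments from time \<open>0\<close> are used since their law and their independence do not refer to the
  exceptional event on which the motion does not start at \<open>0\<close>.\<close>
lemma brownian_box_probability:
  assumes P: "prob_space P" and W: "independent_brownian_motions P F I W"
    and I: "finite I" "I \<noteq> {}" and s: "0 < s" and c: "0 \<le> c"
  shows "{\<omega> \<in> space P. \<forall>i\<in>I. \<bar>W i s \<omega> - W i 0 \<omega> - y i\<bar> \<le> c} \<in> sets P"
    and "measure P {\<omega> \<in> space P. \<forall>i\<in>I. \<bar>W i s \<omega> - W i 0 \<omega> - y i\<bar> \<le> c} \<le> (2 * c / sqrt s) ^ card I"
proof -
  interpret prob_space P by fact
  let ?X = "\<lambda>i \<omega>. W i s \<omega> - W i 0 \<omega>"
  let ?E = "\<lambda>i. {\<omega> \<in> space P. \<bar>?X i \<omega> - y i\<bar> \<le> c}"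
  have X: "distributed P lborel (?X i) (normal_density 0 (sqrt s))" if "i \<in> I" for i
  proof -
    have "standard_brownian_motion P F (W i)"
      using W that by (simp add: independent_brownian_motions_def)
    then have "\<forall>r t. 0 \<le> r \<and> r < t \<longrightarrow>
        distributed P lborel (\<lambda>\<omega>. W i t \<omega> - W i r \<omega>) (normal_density 0 (sqrt (t - r)))"
      by (simp add: standard_brownian_motion_def)
    from this[rule_format, of 0 s] s show ?thesis by simp
  qed
  have Em: "?E i \<in> sets P" if "i \<in> I" for i
  proof -
    have [measurable]: "?X i \<in> borel_measurable P" using distributed_measurable[OF X[OF that]] by simp
    show ?thesis by measurable
  qed
  have eq: "{\<omega> \<in> space P. \<forall>i\<in>I. \<bar>?X i \<omega> - y i\<bar> \<le> c} = (\<Inter>i\<in>I. ?E i)"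
    using I(2) by auto
  show "{\<omega> \<in> space P. \<forall>i\<in>I. \<bar>?X i \<omega> - y i\<bar> \<le> c} \<in> sets P"
    unfolding eq using I Em by (intro sets.finite_INT) auto
  have ev: "?E i \<in> increment_events P (W i) 0 s" for i
  proof -
    have "?E i = (\<lambda>\<omega>. W i s \<omega> - W i 0 \<omega>) -` {y i - c..y i + c} \<inter> space P"
      by (auto simp: abs_le_iff algebra_simps)
    also have "\<dots> \<in> increment_events P (W i) 0 s"
      unfolding increment_events_def by (rule CollectI, rule exI[of _ "{y i - c..y i + c}"]) simp
    finally show ?thesis .
  qed
  have ind: "indep_sets (\<lambda>x. case x of None \<Rightarrow> sets (F 0) | Some i \<Rightarrow> increment_events P (W i) 0 s)
      (insert None (Some ` I))"
    by (rule W[unfolded independent_brownian_motions_def, THEN conjunct2, THEN spec, THEN spec, THEN mp])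
      (use s in simp)
  have "prob (\<Inter>j\<in>Some ` I. ?E (the j)) = (\<Prod>j\<in>Some ` I. prob (?E (the j)))"
    by (rule indep_setsD[OF ind]) (use I ev in auto)
  then have "measure P (\<Inter>i\<in>I. ?E i) = (\<Prod>i\<in>I. measure P (?E i))"
    by (simp add: prod.reindex)
  also have "\<dots> \<le> (\<Prod>i\<in>I. 2 * c / sqrt s)"
    using normal_small_ball[OF P X s c] by (intro prod_mono) auto
  finally show "measure P {\<omega> \<in> space P. \<forall>i\<in>I. \<bar>?X i \<omega> - y i\<bar> \<le> c} \<le> (2 * c / sqrt s) ^ card I"
    unfolding eq by simp
qed

text \<open>The images of the points of a grid of mesh \<open>\<eta>\<close> in the parameter cube. The Lipschitz hypothesis compares
  the coordinates in \<open>Q\<close> only, so it contains the requirement that \<open>\<psi>\<close> depends on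
  nothing else.\<close>
lemma lipschitz_image_cover:
  fixes \<psi> :: "('q \<Rightarrow> real) \<Rightarrow> 'i \<Rightarrow> real"
  assumes Q: "finite Q" and \<eta>: "0 < \<eta>" "\<eta> \<le> 1" and K: "0 \<le> K"
    and Lip: "\<And>u v e. 0 \<le> e \<Longrightarrow> \<forall>p\<in>Q. \<bar>u p\<bar> \<le> K \<and> \<bar>v p\<bar> \<le> K \<and> \<bar>u p - v p\<bar> \<le> e \<Longrightarrow>
      \<forall>i\<in>I. \<bar>\<psi> u i - \<psi> v i\<bar> \<le> B * e"
  obtains Y where "finite Y" "real (card Y) \<le> ((2 * K + 1) / \<eta>) ^ card Q"
    "\<And>u. \<forall>p\<in>Q. \<bar>u p\<bar> \<le> K \<Longrightarrow> \<exists>y\<in>Y. \<forall>i\<in>I. \<bar>\<psi> u i - y i\<bar> \<le> B * \<eta>"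
proof
  define m where "m = \<lfloor>K / \<eta>\<rfloor>"
  let ?G = "PiE Q (\<lambda>_. {- m..m})"
  let ?g = "\<lambda>k p. \<eta> * real_of_int (k p)"
  have m: "0 \<le> m" using K \<eta> by (simp add: m_def)
  have mK: "real_of_int m \<le> K / \<eta>" by (simp add: m_def)
  have fin: "finite ?G" using Q by (intro finite_PiE) auto
  show "finite ((\<lambda>k. \<psi> (?g k)) ` ?G)" using fin by simp
  have "real (card ((\<lambda>k. \<psi> (?g k)) ` ?G)) \<le> real (card ?G)"
    using card_image_le[OF fin] by simp
  also have "\<dots> = (2 * real_of_int m + 1) ^ card Q"
    using Q m by (simp add: card_PiE)
  also have "\<dots> \<le> ((2 * K + 1) / \<eta>) ^ card Q"
  proof (rule power_mono)
    have "2 * real_of_int m + 1 \<le> 2 * (K / \<eta>) + 1 / \<eta>"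
      using mK \<eta> by (intro add_mono) auto
    then show "2 * real_of_int m + 1 \<le> (2 * K + 1) / \<eta>" by (simp add: add_divide_distrib)
  qed (use m in simp)
  finally show "real (card ((\<lambda>k. \<psi> (?g k)) ` ?G)) \<le> ((2 * K + 1) / \<eta>) ^ card Q" .
  fix u assume u: "\<forall>p\<in>Q. \<bar>u p\<bar> \<le> K"
  (* rounding towards zero keeps the grid point inside the cube *)
  define k where "k = restrict (\<lambda>p. if 0 \<le> u p then \<lfloor>u p / \<eta>\<rfloor> else - \<lfloor>- u p / \<eta>\<rfloor>) Q"
  have k: "\<bar>k p\<bar> \<le> m \<and> \<bar>?g k p\<bar> \<le> K \<and> \<bar>u p - ?g k p\<bar> \<le> \<eta>" if p: "p \<in> Q" for p
  proof -
    define n where "n = \<lfloor>\<bar>u p\<bar> / \<eta>\<rfloor>"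
    have n0: "0 \<le> n" using \<eta> by (simp add: n_def)
    have nm: "n \<le> m"
      unfolding n_def m_def using u p \<eta> by (intro floor_mono divide_right_mono) auto
    have n1: "\<eta> * real_of_int n \<le> \<bar>u p\<bar>" "\<bar>u p\<bar> \<le> \<eta> * real_of_int n + \<eta>"
    proof -
      have "real_of_int n \<le> \<bar>u p\<bar> / \<eta>" "\<bar>u p\<bar> / \<eta> \<le> real_of_int n + 1"
        unfolding n_def by linarith+
      then show "\<eta> * real_of_int n \<le> \<bar>u p\<bar>" "\<bar>u p\<bar> \<le> \<eta> * real_of_int n + \<eta>"
        using \<eta> by (auto simp: field_simps)
    qed
    have kp: "k p = (if 0 \<le> u p then n else - n)"
      using p by (auto simp: k_def n_def)
    have nn: "0 \<le> \<eta> * real_of_int n" using n0 \<eta> by simp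
    have uK: "\<bar>u p\<bar> \<le> K" using u p by blast
    show ?thesis
    proof (cases "0 \<le> u p")
      case True
      then show ?thesis using kp n0 nm n1 nn uK by auto
    next
      case False
      then show ?thesis using kp n0 nm n1 nn uK by auto
    qed
  qed
  have "k \<in> ?G"
  proof (rule PiE_I)
    fix p assume "p \<in> Q"
    then show "k p \<in> {- m..m}" using k[of p] by auto
  qed (simp add: k_def)
  moreover have "\<forall>i\<in>I. \<bar>\<psi> u i - \<psi> (?g k) i\<bar> \<le> B * \<eta>"
    by (rule Lip) (use \<eta> u k in auto)
  ultimately show "\<exists>y\<in>(\<lambda>k. \<psi> (?g k)) ` ?G. \<forall>i\<in>I. \<bar>\<psi> u i - y i\<bar> \<le> B * \<eta>" by blast
qed

text \<open>At level \<open>n\<close> there are \<open>O(2 ^ n)\<close> dyadic times and \<open>O(\<theta> powr (- n card Q))\<close> boxes, each reached with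
  probability \<open>O(\<theta> ^ (n card I))\<close>, where \<open>\<theta> = 7 / 8\<close>. The product is \<open>O((2 \<theta> ^ 6) ^ n)\<close>, with
  \<open>2 \<theta> ^ 6 = 117649 / 131072\<close>. A path that hits the image at time \<open>t\<close> is close to it at the
  dyadic time before \<open>t\<close>, so it realizes all but finitely many of these events. Times near \<open>0\<close> are
  excluded because the density of the motion is unbounded there.\<close>
lemma brownian_avoids_lipschitz_cube:
  fixes \<psi> :: "('q \<Rightarrow> real) \<Rightarrow> 'i \<Rightarrow> real"
  assumes P: "prob_space P" and W: "independent_brownian_motions P F I W"
    and I: "finite I" and Q: "finite Q" and codim: "card Q + 6 \<le> card I"
    and K: "0 \<le> K" and B: "0 \<le> B" and q: "0 < q"
    and Lip: "\<And>u v e. 0 \<le> e \<Longrightarrow> \<forall>p\<in>Q. \<bar>u p\<bar> \<le> K \<and> \<bar>v p\<bar> \<le> K \<and> \<bar>u p - v p\<bar> \<le> e \<Longrightarrow>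
      \<forall>i\<in>I. \<bar>\<psi> u i - \<psi> v i\<bar> \<le> B * e"
  shows "AE \<omega> in P. \<forall>t u. 1 / real q \<le> t \<and> t \<le> real q \<and> (\<forall>p\<in>Q. \<bar>u p\<bar> \<le> K) \<longrightarrow>
    (\<exists>i\<in>I. W i t \<omega> \<noteq> \<psi> u i)"
proof -
  interpret prob_space P by fact
  let ?\<theta> = "7 / 8 :: real"
  have Ine: "I \<noteq> {}" using codim by auto
  have "\<exists>Y. finite Y \<and> real (card Y) \<le> ((2 * K + 1) / ?\<theta> ^ n) ^ card Q \<and>
      (\<forall>u. (\<forall>p\<in>Q. \<bar>u p\<bar> \<le> K) \<longrightarrow> (\<exists>y\<in>Y. \<forall>i\<in>I. \<bar>\<psi> u i - y i\<bar> \<le> B * ?\<theta> ^ n))" for n :: nat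
  proof -
    have "0 < ?\<theta> ^ n" "?\<theta> ^ n \<le> 1" by (simp_all add: power_le_one)
    from lipschitz_image_cover[of Q "?\<theta> ^ n" K I \<psi> B, OF Q this K Lip] show ?thesis by metis
  qed
  then obtain Y where Y: "\<And>n. finite (Y n)"
      "\<And>n. real (card (Y n)) \<le> ((2 * K + 1) / ?\<theta> ^ n) ^ card Q"
      "\<And>n u. \<forall>p\<in>Q. \<bar>u p\<bar> \<le> K \<Longrightarrow> \<exists>y\<in>Y n. \<forall>i\<in>I. \<bar>\<psi> u i - y i\<bar> \<le> B * ?\<theta> ^ n"
    by metis
  (* the box radius B * theta^n of the cover, plus the modulus of continuity 7 * theta^n *)
  define c where "c n = (B + 7) * ?\<theta> ^ n" for n :: nat
  have c0: "0 \<le> c n" for n using B by (simp add: c_def)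
  (* the k with 1 / (2 q) <= k / 2^n <= q; rounding a time in [1/q, q] down to level n
     stays in this range if 2^n >= 2 q *)
  define G where "G n = {k. k \<le> q * 2 ^ n \<and> 2 ^ n \<le> 2 * q * k}" for n :: nat
  have Gfin: "finite (G n)" for n
    by (rule finite_subset[of _ "{..q * 2 ^ n}"]) (auto simp: G_def)
  have Gcard: "real (card (G n)) \<le> 2 * real q * 2 ^ n" for n
  proof -
    have "card (G n) \<le> card {..q * 2 ^ n}" by (intro card_mono) (auto simp: G_def)
    moreover have "1 \<le> q * 2 ^ n" using q by simp
    ultimately have "card (G n) \<le> 2 * (q * 2 ^ n)" unfolding card_atMost by linarith
    then have "real (card (G n)) \<le> real (2 * (q * 2 ^ n))" by (simp only: of_nat_le_iff)
    then show ?thesis by simp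
  qed
  have Gtime: "1 / (2 * real q) \<le> real k / 2 ^ n" if "k \<in> G n" for k n
  proof -
    have "real (2 ^ n) \<le> real (2 * q * k)" using that unfolding G_def of_nat_le_iff by simp
    then show ?thesis using q by (simp add: field_simps)
  qed
  define A where "A n = (\<Union>k\<in>G n. \<Union>y\<in>Y n.
      {\<omega> \<in> space P. \<forall>i\<in>I. \<bar>W i (real k / 2 ^ n) \<omega> - W i 0 \<omega> - y i\<bar> \<le> c n})" for n :: nat
  have Gpos: "0 < real k / 2 ^ n" if "k \<in> G n" for k n
    by (rule less_le_trans[OF _ Gtime[OF that]]) (use q in simp)
  have box: "{\<omega> \<in> space P. \<forall>i\<in>I. \<bar>W i (real k / 2 ^ n) \<omega> - W i 0 \<omega> - y i\<bar> \<le> c n} \<in> sets P"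
    "measure P {\<omega> \<in> space P. \<forall>i\<in>I. \<bar>W i (real k / 2 ^ n) \<omega> - W i 0 \<omega> - y i\<bar> \<le> c n}
       \<le> (2 * c n * sqrt (2 * real q)) ^ card I" if k: "k \<in> G n" for k n y
  proof -
    note b = brownian_box_probability[OF P W I Ine Gpos[OF k] c0]
    show "{\<omega> \<in> space P. \<forall>i\<in>I. \<bar>W i (real k / 2 ^ n) \<omega> - W i 0 \<omega> - y i\<bar> \<le> c n} \<in> sets P"
      by (rule b(1))
    have "2 * c n / sqrt (real k / 2 ^ n) \<le> 2 * c n / sqrt (1 / (2 * real q))"
      using Gtime[OF k] Gpos[OF k] c0[of n] q by (intro divide_left_mono) auto
    also have "\<dots> = 2 * c n * sqrt (2 * real q)" by (simp add: real_sqrt_divide)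
    finally have "(2 * c n / sqrt (real k / 2 ^ n)) ^ card I \<le> (2 * c n * sqrt (2 * real q)) ^ card I"
      by (intro power_mono) (use c0 in auto)
    with b(2) show "measure P {\<omega> \<in> space P. \<forall>i\<in>I. \<bar>W i (real k / 2 ^ n) \<omega> - W i 0 \<omega> - y i\<bar> \<le> c n}
       \<le> (2 * c n * sqrt (2 * real q)) ^ card I"
      by (rule order_trans)
  qed
  have Am: "A n \<in> sets P" for n
    unfolding A_def using Gfin Y(1) box(1) by (intro sets.finite_UN) auto
  define C where "C = 2 * real q * (2 * K + 1) ^ card Q * (2 * (B + 7) * sqrt (2 * real q)) ^ card I"
  have C0: "0 \<le> C" using K B by (simp add: C_def)
  have "measure P (A n) \<le> C * (117649 / 131072) ^ n" for n
  proof -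
    have "measure P (A n) \<le> (\<Sum>k\<in>G n. measure P (\<Union>y\<in>Y n.
        {\<omega> \<in> space P. \<forall>i\<in>I. \<bar>W i (real k / 2 ^ n) \<omega> - W i 0 \<omega> - y i\<bar> \<le> c n}))"
      unfolding A_def by (rule finite_measure_subadditive_finite[OF Gfin])
        (use Y(1) box(1) in \<open>auto intro!: sets.finite_UN\<close>)
    also have "\<dots> \<le> (\<Sum>k\<in>G n. \<Sum>y\<in>Y n. measure P
        {\<omega> \<in> space P. \<forall>i\<in>I. \<bar>W i (real k / 2 ^ n) \<omega> - W i 0 \<omega> - y i\<bar> \<le> c n})"
      by (intro sum_mono finite_measure_subadditive_finite[OF Y(1)]) (use box(1) in auto)
    also have "\<dots> \<le> (\<Sum>k\<in>G n. \<Sum>y\<in>Y n. (2 * c n * sqrt (2 * real q)) ^ card I)"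
      by (intro sum_mono box(2))
    also have "\<dots> = real (card (G n)) * (real (card (Y n)) * (2 * c n * sqrt (2 * real q)) ^ card I)"
      by simp
    also have "\<dots> \<le> (2 * real q * 2 ^ n) *
        (((2 * K + 1) / ?\<theta> ^ n) ^ card Q * (2 * c n * sqrt (2 * real q)) ^ card I)"
      using c0[of n] K by (intro mult_mono Gcard Y(2)) auto
    also have "\<dots> = C * (2 ^ n * ((?\<theta> ^ n) ^ card I / (?\<theta> ^ n) ^ card Q))"
    proof -
      have 1: "(2 * c n * sqrt (2 * real q)) ^ card I
          = (2 * (B + 7) * sqrt (2 * real q)) ^ card I * (?\<theta> ^ n) ^ card I"
        unfolding c_def power_mult_distrib[symmetric] by (simp only: mult_ac)
      have 2: "((2 * K + 1) / ?\<theta> ^ n) ^ card Q = (2 * K + 1) ^ card Q / (?\<theta> ^ n) ^ card Q"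
        by (rule power_divide)
      show ?thesis
        unfolding 1 2 C_def by (simp only: times_divide_eq_right times_divide_eq_left mult_ac)
    qed
    also have "(?\<theta> ^ n) ^ card I / (?\<theta> ^ n) ^ card Q = (?\<theta> ^ n) ^ (card I - card Q)"
      using codim by (intro power_diff[symmetric]) auto
    also have "C * (2 ^ n * (?\<theta> ^ n) ^ (card I - card Q)) \<le> C * (2 ^ n * (?\<theta> ^ n) ^ 6)"
      using codim C0 by (intro mult_left_mono power_decreasing) (auto simp: power_le_one)
    also have "2 ^ n * (?\<theta> ^ n) ^ 6 = (2 * ?\<theta> ^ 6) ^ n"
      by (simp only: power_mult_distrib power_mult[symmetric] mult.commute)
    also have "2 * ?\<theta> ^ 6 = 117649 / 131072" by (simp add: power_divide)
    finally show ?thesis .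
  qed
  moreover have "summable (\<lambda>n. C * (117649 / 131072) ^ n)"
    by (intro summable_mult summable_geometric) simp
  ultimately have "summable (\<lambda>n. measure P (A n))"
    using summable_comparison_test'[of "\<lambda>n. C * (117649 / 131072) ^ n" 0 "\<lambda>n. measure P (A n)"] by simp
  then have "AE \<omega> in P. \<forall>\<^sub>F n in sequentially. \<omega> \<in> space P - A n"
    by (rule borel_cantelli_AE1[rotated 2]) (auto simp: emeasure_eq_measure Am)
  moreover have "AE \<omega> in P. \<forall>i\<in>I. W i 0 \<omega> = 0 \<and> (\<forall>\<^sub>F n in sequentially. \<forall>t. 0 \<le> t \<and> t \<le> real q \<longrightarrow>
    \<bar>W i t \<omega> - W i (real (nat \<lfloor>2 ^ n * t\<rfloor>) / 2 ^ n) \<omega>\<bar> \<le> 7 * ?\<theta> ^ n)"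
  proof (rule AE_finite_allI[OF I])
    fix i assume "i \<in> I"
    then have W': "standard_brownian_motion P F (W i)"
      using W by (simp add: independent_brownian_motions_def)
    then have "AE \<omega> in P. W i 0 \<omega> = 0" by (simp add: standard_brownian_motion_def)
    with brownian_dyadic_modulus[OF P W', of q]
    show "AE \<omega> in P. W i 0 \<omega> = 0 \<and> (\<forall>\<^sub>F n in sequentially. \<forall>t. 0 \<le> t \<and> t \<le> real q \<longrightarrow>
      \<bar>W i t \<omega> - W i (real (nat \<lfloor>2 ^ n * t\<rfloor>) / 2 ^ n) \<omega>\<bar> \<le> 7 * ?\<theta> ^ n)"
      by eventually_elim simp
  qed
  ultimately show ?thesis
  proof eventually_elim
    case (elim \<omega>)
    have W0: "W i 0 \<omega> = 0" if "i \<in> I" for i using elim(2) that by blast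
    have "\<forall>\<^sub>F n in sequentially. \<forall>i\<in>I. \<forall>t. 0 \<le> t \<and> t \<le> real q \<longrightarrow>
      \<bar>W i t \<omega> - W i (real (nat \<lfloor>2 ^ n * t\<rfloor>) / 2 ^ n) \<omega>\<bar> \<le> 7 * ?\<theta> ^ n"
      using elim(2) by (intro eventually_ball_finite I) auto
    moreover have "\<forall>\<^sub>F n in sequentially. 2 * q \<le> (2 :: nat) ^ n"
    proof (rule eventually_sequentiallyI[of "2 * q"])
      fix n assume "2 * q \<le> n"
      then show "2 * q \<le> (2 :: nat) ^ n" using less_exp[of n] by linarith
    qed
    ultimately have "\<forall>\<^sub>F n in sequentially. \<omega> \<in> space P - A n \<and> 2 * q \<le> 2 ^ n \<and>
      (\<forall>i\<in>I. \<forall>t. 0 \<le> t \<and> t \<le> real q \<longrightarrow>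
        \<bar>W i t \<omega> - W i (real (nat \<lfloor>2 ^ n * t\<rfloor>) / 2 ^ n) \<omega>\<bar> \<le> 7 * ?\<theta> ^ n)"
      using elim(1) by eventually_elim blast
    then obtain n where n: "\<omega> \<in> space P - A n" "2 * q \<le> 2 ^ n"
      and hol: "\<And>i t. i \<in> I \<Longrightarrow> 0 \<le> t \<Longrightarrow> t \<le> real q \<Longrightarrow>
        \<bar>W i t \<omega> - W i (real (nat \<lfloor>2 ^ n * t\<rfloor>) / 2 ^ n) \<omega>\<bar> \<le> 7 * ?\<theta> ^ n"
      unfolding eventually_sequentially by blast
    show ?case
    proof (intro allI impI)
      fix t u assume tu: "1 / real q \<le> t \<and> t \<le> real q \<and> (\<forall>p\<in>Q. \<bar>u p\<bar> \<le> K)"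
      then have t: "1 / real q \<le> t" "t \<le> real q" by auto
      have t0: "0 \<le> t" using t(1) by (rule order_trans[rotated]) simp
      show "\<exists>i\<in>I. W i t \<omega> \<noteq> \<psi> u i"
      proof (rule ccontr)
        assume "\<not> (\<exists>i\<in>I. W i t \<omega> \<noteq> \<psi> u i)"
        then have hit: "\<And>i. i \<in> I \<Longrightarrow> W i t \<omega> = \<psi> u i" by blast
        define k where "k = nat \<lfloor>2 ^ n * t\<rfloor>"
        have k: "real k \<le> 2 ^ n * t" "2 ^ n * t < real k + 1"
          using t0 by (auto simp: k_def)
        have "real k \<le> real (q * 2 ^ n)"
          by (rule order_trans[OF k(1)]) (use t in \<open>simp add: mult.commute\<close>)
        moreover have "real (2 ^ n) \<le> real (2 * q * k)"
        proof -
          have "2 ^ n \<le> 2 ^ n * (real q * t)"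
            using t(1) q by (simp add: field_simps)
          also have "\<dots> \<le> real q * (real k + 1)"
            using k(2) q by (simp add: mult.left_commute)
          finally have "2 ^ n \<le> real q * real k + real q" by (simp add: algebra_simps)
          moreover have "2 * real q \<le> 2 ^ n"
            using n(2) by (metis of_nat_le_iff of_nat_mult of_nat_numeral of_nat_power)
          ultimately show ?thesis by simp
        qed
        ultimately have kG: "k \<in> G n" unfolding G_def of_nat_le_iff by simp
        obtain y where y: "y \<in> Y n" "\<forall>i\<in>I. \<bar>\<psi> u i - y i\<bar> \<le> B * ?\<theta> ^ n"
          using Y(3) tu by blast
        have "\<bar>W i (real k / 2 ^ n) \<omega> - W i 0 \<omega> - y i\<bar> \<le> c n" if i: "i \<in> I" for i
          using hol[OF i t0 t(2)] y(2) i hit[OF i] W0[OF i]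
          unfolding c_def k_def[symmetric] by (fastforce simp: algebra_simps abs_le_iff)
        then have "\<omega> \<in> A n" using n(1) kG y(1) unfolding A_def by blast
        then show False using n(1) by blast
      qed
    qed
  qed
qed

text \<open>Positive times and all parameters are exhausted by countably many compact pieces. The hypothesis
  on \<open>\<psi>\<close> holds for example for polynomial maps.\<close>
lemma brownian_avoids_lipschitz_image:
  fixes \<psi> :: "('q \<Rightarrow> real) \<Rightarrow> 'i \<Rightarrow> real"
  assumes P: "prob_space P" and W: "independent_brownian_motions P F I W"
    and I: "finite I" and Q: "finite Q" and codim: "card Q + 6 \<le> card I"
    and Lip: "\<And>K. 0 \<le> K \<Longrightarrow> \<exists>B\<ge>0. \<forall>u v e. 0 \<le> e \<and>
        (\<forall>p\<in>Q. \<bar>u p\<bar> \<le> K \<and> \<bar>v p\<bar> \<le> K \<and> \<bar>u p - v p\<bar> \<le> e) \<longrightarrow> (\<forall>i\<in>I. \<bar>\<psi> u i - \<psi> v i\<bar> \<le> B * e)"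
  shows "AE \<omega> in P. \<forall>t>0. \<forall>u. \<exists>i\<in>I. W i t \<omega> \<noteq> \<psi> u i"
proof -
  have "AE \<omega> in P. \<forall>q::nat. \<forall>t u. 1 / real (Suc q) \<le> t \<and> t \<le> real (Suc q) \<and>
      (\<forall>p\<in>Q. \<bar>u p\<bar> \<le> real q) \<longrightarrow> (\<exists>i\<in>I. W i t \<omega> \<noteq> \<psi> u i)"
    unfolding AE_all_countable
  proof
    fix q :: nat
    obtain B where B0: "0 \<le> B" and B: "\<forall>u v e. 0 \<le> e \<and>
        (\<forall>p\<in>Q. \<bar>u p\<bar> \<le> real q \<and> \<bar>v p\<bar> \<le> real q \<and> \<bar>u p - v p\<bar> \<le> e) \<longrightarrow>
        (\<forall>i\<in>I. \<bar>\<psi> u i - \<psi> v i\<bar> \<le> B * e)"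
      using Lip[OF of_nat_0_le_iff, of q] by (elim exE conjE) (rule that)
    show "AE \<omega> in P. \<forall>t u. 1 / real (Suc q) \<le> t \<and> t \<le> real (Suc q) \<and>
      (\<forall>p\<in>Q. \<bar>u p\<bar> \<le> real q) \<longrightarrow> (\<exists>i\<in>I. W i t \<omega> \<noteq> \<psi> u i)"
    proof (rule brownian_avoids_lipschitz_cube[OF P W I Q codim of_nat_0_le_iff B0 zero_less_Suc])
      fix u v :: "'q \<Rightarrow> real" and e :: real
      assume "0 \<le> e" "\<forall>p\<in>Q. \<bar>u p\<bar> \<le> real q \<and> \<bar>v p\<bar> \<le> real q \<and> \<bar>u p - v p\<bar> \<le> e"
      with B show "\<forall>i\<in>I. \<bar>\<psi> u i - \<psi> v i\<bar> \<le> B * e" by simp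
    qed
  qed
  then show ?thesis
  proof eventually_elim
    case (elim \<omega>)
    show ?case
    proof (intro allI impI)
      fix t :: real and u assume t: "0 < t"
      let ?X = "insert t (insert (1 / t) ((\<lambda>p. \<bar>u p\<bar>) ` Q))"
      have "\<forall>x\<in>?X. x \<le> Max ?X" using Q by (intro ballI Max_ge) auto
      then obtain b where "\<forall>x\<in>?X. x \<le> b" by (rule that)
      then have b: "t \<le> b" "1 / t \<le> b" "\<forall>p\<in>Q. \<bar>u p\<bar> \<le> b" by auto
      obtain q :: nat where q: "b \<le> real q" using real_arch_simple by blast
      have "1 / t \<le> real (Suc q)" using b q by simp
      then have "1 / real (Suc q) \<le> t" using t by (simp add: field_simps)
      moreover have "\<forall>p\<in>Q. \<bar>u p\<bar> \<le> real q" using b(3) q by (meson order_trans)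
      moreover have "t \<le> real (Suc q)" using b(1) q by simp
      ultimately show "\<exists>i\<in>I. W i t \<omega> \<noteq> \<psi> u i" using elim by blast
    qed
  qed
qed

section \<open>The overlap system of the matrix-valued Brownian motion\<close>

text \<open>Real and imaginary parts of the array of parameters are separate real coordinates, as are those of
  the matrix entries. Leaving out the three idle positions of the array gives the codimension \<open>6\<close>.\<close>
lemma matrix_brownian_motion_avoids_degenerate:
  assumes P: "prob_space P"
    and W: "independent_brownian_motions P F
      (({..<N} \<times> {..<N}) <+> ({..<N} \<times> {..<N})) (case_sum BR BI)"
    and ab: "a < N" "b < N" "a \<noteq> b"
  shows "AE \<omega> in P. \<forall>t>0. \<forall>w. \<exists>p<N. \<exists>q<N.
    matrix_brownian_motion N M0 BR BI t \<omega> $$ (p, q) \<noteq> degenerate_entry N a b w (p, q)"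
proof -
  let ?E = "{..<N} \<times> {..<N}"
  let ?Q = "?E - {(a, b), (b, a), (b, b)}"
  let ?s = "sqrt (2 * real N)"
  define cpx :: "(nat \<times> nat + nat \<times> nat \<Rightarrow> real) \<Rightarrow> nat \<times> nat \<Rightarrow> complex"
    where "cpx u i = Complex (u (Inl i)) (u (Inr i))" for u i
  define \<psi> where "\<psi> u i = (case i of
      Inl pq \<Rightarrow> ?s * Re (degenerate_entry N a b (cpx u) pq - M0 $$ pq)
    | Inr pq \<Rightarrow> ?s * Im (degenerate_entry N a b (cpx u) pq - M0 $$ pq))" for u i
  have s: "0 < ?s" using ab by simp
  have three: "card {(a, b), (b, a), (b, b)} = 3" using ab by simp
  have "card ?Q + 3 = card ?E"
  proof -
    have "card ?Q = card ?E - card {(a, b), (b, a), (b, b)}"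
      using ab by (intro card_Diff_subset) auto
    moreover have "card {(a, b), (b, a), (b, b)} \<le> card ?E"
      using ab by (intro card_mono) auto
    ultimately show ?thesis using three by simp
  qed
  then have codim: "card (?Q <+> ?Q) + 6 \<le> card (?E <+> ?E)"
    by (simp add: card_Plus del: card_cartesian_product)
  have "AE \<omega> in P. \<forall>t>0. \<forall>u. \<exists>i\<in>?E <+> ?E. case_sum BR BI i t \<omega> \<noteq> \<psi> u i"
  proof (rule brownian_avoids_lipschitz_image[OF P W _ _ codim])
    fix K :: real
    assume K: "0 \<le> K"
    let ?B = "?s * ((2 * real N * (2 * K) + 2) * 2)"
    have lip: "\<forall>i\<in>?E <+> ?E. \<bar>\<psi> u i - \<psi> v i\<bar> \<le> ?B * e"
      if e: "0 \<le> e" and uv: "\<forall>p\<in>?Q <+> ?Q. \<bar>u p\<bar> \<le> K \<and> \<bar>v p\<bar> \<le> K \<and> \<bar>u p - v p\<bar> \<le> e" for u v e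
    proof
      have norms: "cmod (cpx u i) \<le> 2 * K \<and> cmod (cpx v i) \<le> 2 * K \<and> cmod (cpx u i - cpx v i) \<le> 2 * e"
        if "i \<in> ?Q" for i
      proof -
        have "Inl i \<in> ?Q <+> ?Q" "Inr i \<in> ?Q <+> ?Q" using that by auto
        with uv have "\<bar>u (Inl i)\<bar> \<le> K" "\<bar>v (Inl i)\<bar> \<le> K" "\<bar>u (Inl i) - v (Inl i)\<bar> \<le> e"
          "\<bar>u (Inr i)\<bar> \<le> K" "\<bar>v (Inr i)\<bar> \<le> K" "\<bar>u (Inr i) - v (Inr i)\<bar> \<le> e" by blast+
        then show ?thesis
          using cmod_le[of "cpx u i"] cmod_le[of "cpx v i"] cmod_le[of "cpx u i - cpx v i"]
          by (simp add: cpx_def)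
      qed
      let ?d = "\<lambda>pq. degenerate_entry N a b (cpx u) pq - degenerate_entry N a b (cpx v) pq"
      have d: "cmod (?d pq) \<le> (2 * real N * (2 * K) + 2) * (2 * e)" if pq: "pq \<in> ?E" for pq
      proof -
        have "cmod (?d (fst pq, snd pq)) \<le> (2 * real N * (2 * K) + 2) * (2 * e)"
          by (rule degenerate_entry_lipschitz[OF ab]) (use pq K e norms in auto)
        then show ?thesis by simp
      qed
      fix i assume i: "i \<in> ?E <+> ?E"
      then obtain pq where pq: "pq \<in> ?E" "i = Inl pq \<or> i = Inr pq" by auto
      have "\<psi> u i - \<psi> v i = ?s * Re (?d pq) \<or> \<psi> u i - \<psi> v i = ?s * Im (?d pq)"
        using pq(2) by (auto simp: \<psi>_def right_diff_distrib)
      then have "\<bar>\<psi> u i - \<psi> v i\<bar> \<le> ?s * cmod (?d pq)"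
      proof
        assume "\<psi> u i - \<psi> v i = ?s * Re (?d pq)"
        then show ?thesis using s abs_Re_le_cmod[of "?d pq"] by (simp only: abs_mult) simp
      next
        assume "\<psi> u i - \<psi> v i = ?s * Im (?d pq)"
        then show ?thesis using s abs_Im_le_cmod[of "?d pq"] by (simp only: abs_mult) simp
      qed
      also have "\<dots> \<le> ?s * ((2 * real N * (2 * K) + 2) * (2 * e))"
        using d[OF pq(1)] s by (intro mult_left_mono) auto
      also have "\<dots> = ?B * e" by (simp only: mult.assoc)
      finally show "\<bar>\<psi> u i - \<psi> v i\<bar> \<le> ?B * e" .
    qed
    show "\<exists>B\<ge>0. \<forall>u v e. 0 \<le> e \<and>
        (\<forall>p\<in>?Q <+> ?Q. \<bar>u p\<bar> \<le> K \<and> \<bar>v p\<bar> \<le> K \<and> \<bar>u p - v p\<bar> \<le> e) \<longrightarrow>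
        (\<forall>i\<in>?E <+> ?E. \<bar>\<psi> u i - \<psi> v i\<bar> \<le> B * e)"
    proof (intro exI[of _ ?B] conjI allI impI)
      show "0 \<le> ?B" using K by simp
      fix u v :: "nat \<times> nat + nat \<times> nat \<Rightarrow> real" and e :: real
      assume "0 \<le> e \<and> (\<forall>p\<in>?Q <+> ?Q. \<bar>u p\<bar> \<le> K \<and> \<bar>v p\<bar> \<le> K \<and> \<bar>u p - v p\<bar> \<le> e)"
      then show "\<forall>i\<in>?E <+> ?E. \<bar>\<psi> u i - \<psi> v i\<bar> \<le> ?B * e"
        by (elim conjE) (rule lip)
    qed
  qed auto
  then show ?thesis
  proof eventually_elim
    case (elim \<omega>)
    show ?case
    proof (intro allI impI)
      fix t :: real and w assume t: "0 < t"
      show "\<exists>p<N. \<exists>q<N. matrix_brownian_motion N M0 BR BI t \<omega> $$ (p, q) \<noteq> degenerate_entry N a b w (p, q)"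
      proof (rule ccontr)
        assume "\<not> ?thesis"
        then have eq: "matrix_brownian_motion N M0 BR BI t \<omega> $$ (p, q) = degenerate_entry N a b w (p, q)"
          if "p < N" "q < N" for p q using that by blast
        define u where "u = case_sum (\<lambda>i. Re (w i)) (\<lambda>i. Im (w i))"
        have cpx: "cpx u = w" by (rule ext) (simp add: cpx_def u_def)
        obtain i where i: "i \<in> ?E <+> ?E" "case_sum BR BI i t \<omega> \<noteq> \<psi> u i" using elim t by blast
        obtain p q where pq: "p < N" "q < N" "i = Inl (p, q) \<or> i = Inr (p, q)" using i(1) by auto
        have "degenerate_entry N a b w (p, q) - M0 $$ (p, q) =
            (complex_of_real (BR (p, q) t \<omega>) + \<i> * complex_of_real (BI (p, q) t \<omega>)) / complex_of_real ?s"
          using eq[OF pq(1,2)] pq by (simp add: matrix_brownian_motion_def algebra_simps)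
        then have "?s * Re (degenerate_entry N a b w (p, q) - M0 $$ (p, q)) = BR (p, q) t \<omega>"
          "?s * Im (degenerate_entry N a b w (p, q) - M0 $$ (p, q)) = BI (p, q) t \<omega>"
          using s by simp_all
        then show False using i(2) pq(3) by (auto simp: \<psi>_def cpx)
      qed
    qed
  qed
qed

text \<open>A matrix with biorthogonal eigenvectors and a repeated eigenvalue is in the image of one of the
  finitely many maps \<open>degenerate_entry N a b\<close>. The choice of \<open>lam\<close>, \<open>r\<close>, \<open>l\<close> is quantified inside
  the almost sure event, because the eigenvector processes may be arbitrary, even
  non-measurable, functions of the sample point.\<close>
lemma diagonalizable_brownian_spectrum_distinct:
  assumes P: "prob_space P"
    and W: "independent_brownian_motions P F
      (({..<N} \<times> {..<N}) <+> ({..<N} \<times> {..<N})) (case_sum BR BI)"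
  shows "AE \<omega> in P. \<forall>t>0. \<forall>lam r l.
    biorthogonal_eigenvectors N (matrix_brownian_motion N M0 BR BI t \<omega>) lam r l \<longrightarrow> inj_on lam {..<N}"
proof -
  have "AE \<omega> in P. \<forall>ab\<in>{ab \<in> {..<N} \<times> {..<N}. fst ab \<noteq> snd ab}. \<forall>t>0. \<forall>w. \<exists>p<N. \<exists>q<N.
    matrix_brownian_motion N M0 BR BI t \<omega> $$ (p, q) \<noteq> degenerate_entry N (fst ab) (snd ab) w (p, q)"
    by (intro AE_finite_allI matrix_brownian_motion_avoids_degenerate[OF P W]) auto
  then show ?thesis
  proof eventually_elim
    case (elim \<omega>)
    have car: "matrix_brownian_motion N M0 BR BI t \<omega> \<in> carrier_mat N N" for t
      by (simp add: matrix_brownian_motion_def)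
    show ?case
    proof (intro allI impI inj_onI, rule ccontr)
      fix t :: real and lam r l j k
      assume t: "0 < t" and b: "biorthogonal_eigenvectors N (matrix_brownian_motion N M0 BR BI t \<omega>) lam r l"
        and jk: "j \<in> {..<N}" "k \<in> {..<N}" "lam j = lam k" "j \<noteq> k"
      obtain a c w where ac: "a < N" "c < N" "a \<noteq> c" and
        eq: "\<forall>p<N. \<forall>q<N. matrix_brownian_motion N M0 BR BI t \<omega> $$ (p, q) = degenerate_entry N a c w (p, q)"
        using degenerate_parametrisation[OF car b, of j k] jk by auto
      have "(a, c) \<in> {ab \<in> {..<N} \<times> {..<N}. fst ab \<noteq> snd ab}" using ac by simp
      from bspec[OF elim this] t eq show False by auto
    qed
  qed
qed

theorem theorem1p3:
  fixes P :: "'w measure"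
    and F :: "real \<Rightarrow> 'w measure"
    and N :: nat
    and BR BI :: "nat \<times> nat \<Rightarrow> real \<Rightarrow> 'w \<Rightarrow> real"
    and M0 :: "complex mat"
    and M :: "real \<Rightarrow> 'w \<Rightarrow> complex mat"
    and \<Lambda> :: "nat \<Rightarrow> real \<Rightarrow> 'w \<Rightarrow> complex"
    and R L :: "nat \<Rightarrow> real \<Rightarrow> 'w \<Rightarrow> complex Matrix.vec"
  assumes "N \<ge> 1"
    and "filtered_prob_space P F"
    and "independent_brownian_motions P F
           (({..<N} \<times> {..<N}) <+> ({..<N} \<times> {..<N})) (case_sum BR BI)"
    and "M0 \<in> carrier_mat N N"
    and "simple_spectrum M0"
    and "M = matrix_brownian_motion N M0 BR BI"
    and "eigenvalue_process P N M \<Lambda>"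
    and "eigenvector_process P N M \<Lambda> R L"
  shows
    "\<comment> \<open>invariance under the scale transformation\<close>
    (\<forall>c :: nat \<Rightarrow> real \<Rightarrow> 'w \<Rightarrow> complex.
       (AE \<omega> in P. \<forall>t\<ge>0. \<forall>j<N. c j t \<omega> \<noteq> 0) \<longrightarrow>
         eigenvector_process P N M \<Lambda>
           (\<lambda>j t \<omega>. c j t \<omega> \<cdot>\<^sub>v R j t \<omega>) (\<lambda>j t \<omega>. (1 / c j t \<omega>) \<cdot>\<^sub>v L j t \<omega>) \<and>
         (AE \<omega> in P. \<forall>t\<ge>0.
           eigenvector_matrix N (\<lambda>j. c j t \<omega> \<cdot>\<^sub>v R j t \<omega>) =
             eigenvector_matrix N (\<lambda>j. R j t \<omega>) * mat_diag N (\<lambda>j. c j t \<omega>) \<and>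
           same_overlap_system N (\<lambda>j. \<Lambda> j t \<omega>)
             (eigenvector_matrix N (\<lambda>j. R j t \<omega>))
             (eigenvector_matrix N (\<lambda>j. R j t \<omega>) * mat_diag N (\<lambda>j. c j t \<omega>)))) \<and>
    \<comment> \<open>the eigenvector processes are not determined by the eigenvalue process\<close>
    (\<exists>R' L'. eigenvector_process P N M \<Lambda> R' L' \<and>
       (AE \<omega> in P. \<forall>t\<ge>0. \<forall>j<N. R' j t \<omega> \<noteq> R j t \<omega> \<and> L' j t \<omega> \<noteq> L j t \<omega>)) \<and>
    \<comment> \<open>but the system of SDEs is\<close>
    (\<forall>R' L'. eigenvector_process P N M \<Lambda> R' L' \<longrightarrow>
       (AE \<omega> in P. \<forall>t\<ge>0. same_overlap_system N (\<lambda>j. \<Lambda> j t \<omega>)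
          (eigenvector_matrix N (\<lambda>j. R j t \<omega>)) (eigenvector_matrix N (\<lambda>j. R' j t \<omega>))))"
proof -
  note P = assms(2)[unfolded filtered_prob_space_def, THEN conjunct1]
  have car: "M t \<omega> \<in> carrier_mat N N" for t \<omega>
    unfolding assms(6) by (simp add: matrix_brownian_motion_def)
  note RL = assms(8)[unfolded eigenvector_process_def]
  have scaled: "eigenvector_process P N M \<Lambda>
        (\<lambda>j t \<omega>. c j t \<omega> \<cdot>\<^sub>v R j t \<omega>) (\<lambda>j t \<omega>. (1 / c j t \<omega>) \<cdot>\<^sub>v L j t \<omega>)"
    if c: "AE \<omega> in P. \<forall>t\<ge>0. \<forall>j<N. c j t \<omega> \<noteq> 0" for c
    unfolding eigenvector_process_def using c RL
    by eventually_elim (auto intro!: biorthogonal_eigenvectors_scale[OF car])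
  have invariant: "AE \<omega> in P. \<forall>t\<ge>0.
      eigenvector_matrix N (\<lambda>j. c j t \<omega> \<cdot>\<^sub>v R j t \<omega>) =
        eigenvector_matrix N (\<lambda>j. R j t \<omega>) * mat_diag N (\<lambda>j. c j t \<omega>) \<and>
      same_overlap_system N (\<lambda>j. \<Lambda> j t \<omega>)
        (eigenvector_matrix N (\<lambda>j. R j t \<omega>))
        (eigenvector_matrix N (\<lambda>j. R j t \<omega>) * mat_diag N (\<lambda>j. c j t \<omega>))"
    if c: "AE \<omega> in P. \<forall>t\<ge>0. \<forall>j<N. c j t \<omega> \<noteq> 0" for c
    using c RL
  proof eventually_elim
    case (elim \<omega>)
    show ?case
    proof (intro allI impI)
      fix t :: real assume t: "0 \<le> t"
      have b: "biorthogonal_eigenvectors N (M t \<omega>) (\<lambda>j. \<Lambda> j t \<omega>) (\<lambda>j. R j t \<omega>) (\<lambda>j. L j t \<omega>)"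
        and c0: "\<forall>j<N. c j t \<omega> \<noteq> 0" using elim t by auto
      show "eigenvector_matrix N (\<lambda>j. c j t \<omega> \<cdot>\<^sub>v R j t \<omega>) =
        eigenvector_matrix N (\<lambda>j. R j t \<omega>) * mat_diag N (\<lambda>j. c j t \<omega>) \<and>
        same_overlap_system N (\<lambda>j. \<Lambda> j t \<omega>)
          (eigenvector_matrix N (\<lambda>j. R j t \<omega>))
          (eigenvector_matrix N (\<lambda>j. R j t \<omega>) * mat_diag N (\<lambda>j. c j t \<omega>))"
        using eigenvector_matrix_scale[of N "\<lambda>j. R j t \<omega>"] biorthogonal_carrier(1)[OF car b]
          same_overlap_system_eigenvectors_scale[OF car b c0] by simp
    qed
  qed
  (* a fixed point of the scaling by 2 or 1/2 would contradict the normalization of the pairing *)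
  have nonunique: "AE \<omega> in P. \<forall>t\<ge>0. \<forall>j<N. 2 \<cdot>\<^sub>v R j t \<omega> \<noteq> R j t \<omega> \<and> (1 / 2) \<cdot>\<^sub>v L j t \<omega> \<noteq> L j t \<omega>"
    using RL
  proof eventually_elim
    case (elim \<omega>)
    show ?case
    proof (intro allI impI)
      fix t :: real and j assume t: "0 \<le> t" and j: "j < N"
      have b: "biorthogonal_eigenvectors N (M t \<omega>) (\<lambda>j. \<Lambda> j t \<omega>) (\<lambda>j. R j t \<omega>) (\<lambda>j. L j t \<omega>)"
        using elim t by auto
      note cv = biorthogonal_carrier[OF car b j]
      have "L j t \<omega> \<bullet> R j t \<omega> = 1" using b j by (auto simp: biorthogonal_eigenvectors_def)
      then show "2 \<cdot>\<^sub>v R j t \<omega> \<noteq> R j t \<omega> \<and> (1 / 2) \<cdot>\<^sub>v L j t \<omega> \<noteq> L j t \<omega>"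
        using scalar_prod_smult_distrib[OF cv(2,1), of 2] smult_scalar_prod_distrib[OF cv(2,1), of "1 / 2"]
        by auto
    qed
  qed
  have distinct: "AE \<omega> in P. \<forall>t\<ge>0. inj_on (\<lambda>j. \<Lambda> j t \<omega>) {..<N}"
    using diagonalizable_brownian_spectrum_distinct[OF P assms(3), of M0]
      assms(7)[unfolded eigenvalue_process_def] RL
  proof eventually_elim
    case (elim \<omega>)
    show ?case
    proof (intro allI impI)
      fix t :: real assume t: "0 \<le> t"
      show "inj_on (\<lambda>j. \<Lambda> j t \<omega>) {..<N}"
      proof (cases "t = 0")
        case True
        (* no density bound is available at time 0; there the order of the labels gives distinctness *)
        have "complex_lex_less (\<Lambda> j 0 \<omega>) (\<Lambda> k 0 \<omega>)" if "j < k" "k < N" for j k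
          using elim(2) that by blast
        then have "\<Lambda> j 0 \<omega> \<noteq> \<Lambda> k 0 \<omega>" if "j < k" "k < N" for j k
          using that by (metis complex_lex_less_def less_irrefl)
        then show ?thesis using True by (auto simp: inj_on_def) (metis linorder_neqE_nat)
      next
        case False
        then have "0 < t" using t by simp
        moreover have "biorthogonal_eigenvectors N (M t \<omega>) (\<lambda>j. \<Lambda> j t \<omega>) (\<lambda>j. R j t \<omega>) (\<lambda>j. L j t \<omega>)"
          using elim(3) t by blast
        ultimately show ?thesis using elim(1) unfolding assms(6) by blast
      qed
    qed
  qed
  have determined: "AE \<omega> in P. \<forall>t\<ge>0. same_overlap_system N (\<lambda>j. \<Lambda> j t \<omega>)
          (eigenvector_matrix N (\<lambda>j. R j t \<omega>)) (eigenvector_matrix N (\<lambda>j. R' j t \<omega>))"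
    if RL': "eigenvector_process P N M \<Lambda> R' L'" for R' L'
    using distinct RL RL'[unfolded eigenvector_process_def]
  proof eventually_elim
    case (elim \<omega>)
    show ?case
    proof (intro allI impI)
      fix t :: real assume t: "0 \<le> t"
      have b: "biorthogonal_eigenvectors N (M t \<omega>) (\<lambda>j. \<Lambda> j t \<omega>) (\<lambda>j. R j t \<omega>) (\<lambda>j. L j t \<omega>)"
        and b': "biorthogonal_eigenvectors N (M t \<omega>) (\<lambda>j. \<Lambda> j t \<omega>) (\<lambda>j. R' j t \<omega>) (\<lambda>j. L' j t \<omega>)"
        and inj: "inj_on (\<lambda>j. \<Lambda> j t \<omega>) {..<N}" using elim t by auto
      obtain c where c: "\<forall>j<N. c j \<noteq> 0" "\<forall>j<N. R' j t \<omega> = c j \<cdot>\<^sub>v R j t \<omega>"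
        using biorthogonal_eigenvectors_unique[OF car inj b b'] by blast
      have "eigenvector_matrix N (\<lambda>j. R' j t \<omega>) = eigenvector_matrix N (\<lambda>j. c j \<cdot>\<^sub>v R j t \<omega>)"
        unfolding eigenvector_matrix_def using c(2)
        by (intro arg_cong[where f = "mat_of_cols N"] map_cong) auto
      also have "\<dots> = eigenvector_matrix N (\<lambda>j. R j t \<omega>) * mat_diag N c"
        by (rule eigenvector_matrix_scale) (use biorthogonal_carrier(1)[OF car b] in blast)
      finally show "same_overlap_system N (\<lambda>j. \<Lambda> j t \<omega>)
          (eigenvector_matrix N (\<lambda>j. R j t \<omega>)) (eigenvector_matrix N (\<lambda>j. R' j t \<omega>))"
        using same_overlap_system_eigenvectors_scale[OF car b c(1)] by simp
    qed
  qed
  have "\<exists>R' L'. eigenvector_process P N M \<Lambda> R' L' \<and>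
       (AE \<omega> in P. \<forall>t\<ge>0. \<forall>j<N. R' j t \<omega> \<noteq> R j t \<omega> \<and> L' j t \<omega> \<noteq> L j t \<omega>)"
    using scaled[of "\<lambda>_ _ _. 2"] nonunique by auto
  then show ?thesis
    using scaled invariant determined by blast
qed

end
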